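(* Let $\Pi=\mathbb{R}/\mathbb{Z}$ be the circle. Let $a\in C^2(\Pi)$ with $a>0$, $b\in C^1(\Pi)$ and $c\in C^0(\Pi)$. Assume that $b$ changes sign on $\Pi$ (it takes both positive and negative values), and that the zero set of $b$ consists of a finite number of isolated zeros and a finite number of maximal (non-degenerate) intervals on which $b$ vanishes. For $\epsilon>0$ let $\lambda_\epsilon$ be the principal eigenvalue of the operator $L_\epsilon u=\epsilon\,a\,u''+b\,u'+c\,u$ on $\Pi$. Then $$\lim_{\epsilon\to 0}\lambda_\epsilon=\max_{x:\,b(x)=0}\bigl(-\max(0,b'(x))+c(x)\bigr).$$
   Context: The principal eigenvalue of $L_\epsilon$ is the eigenvalue with maximal real part (it is real, and admits a positive eigenfunction in $C^2(\Pi)$). *)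

theory Defs
  imports "HOL-Analysis.Analysis" "HOL-Library.Periodic_Fun"
begin

text \<open>
  Functions on the circle $\mathbb{R}/\mathbb{Z}$ are represented by their lifts to the real line,
  i.e. by functions of period 1.
\<close>

primrec Ck :: "nat \<Rightarrow> (real \<Rightarrow> 'a::real_normed_vector) \<Rightarrow> bool" where
  "Ck 0 f \<longleftrightarrow> continuous_on UNIV f"
| "Ck (Suc k) f \<longleftrightarrow>
     (\<forall>x. f differentiable (at x)) \<and> Ck k (\<lambda>x. vector_derivative f (at x))"

definition circle_Ck :: "nat \<Rightarrow> (real \<Rightarrow> 'a::real_normed_vector) \<Rightarrow> bool" where
  "circle_Ck k f \<longleftrightarrow> periodic_fun_simple' f \<and> Ck k f"

text \<open>
  The spectrum of a real non-self-adjoint operator may be complex, so the operator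
  acts on complex-valued functions.
\<close>

definition circle_op ::
  "(real \<Rightarrow> real) \<Rightarrow> (real \<Rightarrow> real) \<Rightarrow> (real \<Rightarrow> real) \<Rightarrow> real \<Rightarrow> (real \<Rightarrow> complex) \<Rightarrow> real \<Rightarrow> complex"
where
  "circle_op a b c \<epsilon> u x =
     complex_of_real (\<epsilon> * a x) * vector_derivative (\<lambda>y. vector_derivative u (at y)) (at x)
     + complex_of_real (b x) * vector_derivative u (at x)
     + complex_of_real (c x) * u x"

definition circle_eigenvalue :: "((real \<Rightarrow> complex) \<Rightarrow> real \<Rightarrow> complex) \<Rightarrow> complex \<Rightarrow> bool" where
  "circle_eigenvalue L \<mu> \<longleftrightarrow>
     (\<exists>u. circle_Ck 2 u \<and> (\<exists>x. u x \<noteq> 0) \<and> (\<forall>x. L u x = \<mu> * u x))"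

definition principal_eigenvalue :: "((real \<Rightarrow> complex) \<Rightarrow> real \<Rightarrow> complex) \<Rightarrow> real \<Rightarrow> bool" where
  "principal_eigenvalue L \<Lambda> \<longleftrightarrow>
     circle_eigenvalue L (complex_of_real \<Lambda>) \<and> (\<forall>\<mu>. circle_eigenvalue L \<mu> \<longrightarrow> Re \<mu> \<le> \<Lambda>)"

text \<open>
  The members of \<^term>\<open>components Z\<close> are the maximal connected subsets of \<open>Z\<close>, so \<open>{s..t} \<in> components Z\<close>
  with \<open>s < t\<close> says that \<open>{s..t}\<close> is a maximal non-degenerate interval on which \<open>b\<close> vanishes.
  Finiteness is meant on the circle: zeros, and intervals through their left endpoints, are
  counted modulo 1. The definition is only meant for \<open>b\<close> that does not vanish identically, so
  that no such interval is the whole line.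
\<close>

definition finite_zero_structure :: "(real \<Rightarrow> real) \<Rightarrow> bool" where
  "finite_zero_structure b \<longleftrightarrow>
     (let Z = {x. b x = 0} in
        (\<forall>x\<in>Z. x isolated_in Z \<or> (\<exists>s t. s < t \<and> x \<in> {s..t} \<and> {s..t} \<in> components Z)) \<and>
        finite {x \<in> {0..<1}. x isolated_in Z} \<and>
        finite {(s, t). s \<in> {0..<1} \<and> s < t \<and> {s..t} \<in> components Z})"

end

(*
  Upper bound. For w = exp (- Theta / eps) with Theta' = psi b / a one has
    L_eps w / w = c - a (psi b / a)' - psi (1 - psi) b^2 / (eps a),
  and the last term is a penalty that, for small eps, only leaves the zeros of b, where the value is
  c - psi b'. The cutoff psi is a logistic function of a difference quotient of b, so that psi b' is
  close to max(0, b') at the zeros; multiplied by a factor that is 1 at the zeros of b it makes the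
  mean of psi b / a vanish, so that Theta is periodic. This balancing is possible because b changes
  sign. Then w is a positive supersolution on the circle.

  Lower bound. A Gaussian bump at a zero of b is a subsolution. It is compared with a positive
  eigenfunction, whose eigenvalue is at most the principal one. A positive eigenfunction of
  u'' + B u' + C u = mu A u comes from the largest mu that admits a nonnegative subsolution, since
  p (p + B) - D^2 - B D = (p + B + D) (p - D) has an explicit, compact, strictly positive inverse.
*)

theory Submission
  imports Defs "HOL-Complex_Analysis.Great_Picard"
begin

section \<open>Continuous functions on the circle\<close>

text \<open>With w = exp (- Theta / eps) and p = Theta', the order 1 / eps part of L_eps w / w is (a
  p^2 - b p) / eps. It is nonpositive exactly when p lies between the roots 0 and b / a, hence the
  form p = psi b / a with 0 < psi < 1; strictness confines equality to the zeros of b. There the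
  next order, c - psi b', should be as small as possible: psi near 0 suits zeros with b' < 0, psi
  near 1 suits zeros with b' > 0. Two obstacles shape psi. It must be differentiable while b' is
  only continuous, so a difference quotient stands in for b'; and the choice dictated by the zeros
  generally gives psi b / a a nonzero mean, which has to be corrected away from the zeros.
  \<open>principal_eigenvalue\<close> speaks only of the maximal real part. Against a supersolution
  any real eigenfunction will do, since it or its negative is positive somewhere. Against a
  subsolution a positive one is called for, and it has to be constructed.\<close>

lemma circle_Ck_0_iff:
  "circle_Ck 0 f \<longleftrightarrow> continuous_on UNIV f \<and> (\<forall>x. f (x + 1) = f x)"
  by (auto simp: circle_Ck_def periodic_fun_simple'_def)

lemma circle_Ck_0_isCont: "circle_Ck 0 f \<Longrightarrow> isCont f x"
  by (simp add: circle_Ck_0_iff continuous_on_eq_continuous_at)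

lemma circle_Ck_0_period: "circle_Ck 0 f \<Longrightarrow> f (x + 1) = f x"
  by (simp add: circle_Ck_0_iff)

lemma circle_Ck_0_minus_of_int:
  assumes "circle_Ck 0 f"
  shows "f (x - of_int n) = f x"
proof -
  interpret periodic_fun_simple' f
    using assms by (simp add: circle_Ck_def)
  show ?thesis by (rule minus_of_int)
qed

lemma circle_Ck_0_frac: "circle_Ck 0 f \<Longrightarrow> f (frac x) = f x"
  by (simp add: frac_def circle_Ck_0_minus_of_int)

lemma circle_Ck_0_attains_max:
  fixes f :: "real \<Rightarrow> real"
  assumes "circle_Ck 0 f"
  obtains x where "x \<in> {0..1}" "\<And>y. f y \<le> f x"
proof -
  have "continuous_on {0..1} f"
    using assms continuous_on_subset by (auto simp: circle_Ck_0_iff)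
  then obtain x where x: "x \<in> {0..1}" "\<And>y. y \<in> {0..1} \<Longrightarrow> f y \<le> f x"
    using continuous_attains_sup[of "{0..1::real}" f] by auto
  have "f y \<le> f x" for y
    using x(2)[of "frac y"] circle_Ck_0_frac[OF assms, of y]
    by (simp add: frac_ge_0 less_imp_le[OF frac_lt_1])
  with x(1) show thesis by (rule that)
qed

lemma
  fixes f g :: "real \<Rightarrow> real"
  assumes "circle_Ck 0 f" "circle_Ck 0 g"
  shows circle_Ck_0_add: "circle_Ck 0 (\<lambda>x. f x + g x)"
    and circle_Ck_0_diff: "circle_Ck 0 (\<lambda>x. f x - g x)"
    and circle_Ck_0_mult: "circle_Ck 0 (\<lambda>x. f x * g x)"
    and circle_Ck_0_divide: "(\<And>x. g x \<noteq> 0) \<Longrightarrow> circle_Ck 0 (\<lambda>x. f x / g x)"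
  using assms by (auto simp: circle_Ck_0_iff intro!: continuous_intros)

lemma circle_Ck_0_const: "circle_Ck 0 (\<lambda>x. k)"
  by (simp add: circle_Ck_0_iff)

lemma circle_Ck_0_uminus:
  fixes f :: "real \<Rightarrow> real"
  shows "circle_Ck 0 f \<Longrightarrow> circle_Ck 0 (\<lambda>x. - f x)"
  by (auto simp: circle_Ck_0_iff intro!: continuous_intros)

lemma circle_Ck_0_reflect:
  fixes f :: "real \<Rightarrow> real"
  assumes "circle_Ck 0 f"
  shows "circle_Ck 0 (\<lambda>x. f (- x))"
proof -
  have "f (- (x + 1)) = f (- x)" for x
    using circle_Ck_0_period[OF assms, of "- x - 1"] by simp
  moreover have "continuous_on UNIV (\<lambda>x. f (- x))"
    using assms by (auto simp: circle_Ck_0_iff intro!: continuous_on_compose2[of UNIV f] continuous_intros)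
  ultimately show ?thesis by (auto simp: circle_Ck_0_iff)
qed

lemmas circle_Ck_0_intros =
  circle_Ck_0_add circle_Ck_0_diff circle_Ck_0_mult circle_Ck_0_divide
  circle_Ck_0_const circle_Ck_0_uminus

lemma circle_Ck_0_attains_min:
  fixes f :: "real \<Rightarrow> real"
  assumes "circle_Ck 0 f"
  obtains x where "x \<in> {0..1}" "\<And>y. f x \<le> f y"
  using circle_Ck_0_attains_max[OF circle_Ck_0_uminus[OF assms]] by auto

lemma circle_Ck_0_bounded:
  fixes f :: "real \<Rightarrow> real"
  assumes "circle_Ck 0 f"
  obtains M where "M > 0" "\<And>x. \<bar>f x\<bar> \<le> M"
proof -
  obtain x y where *: "\<And>z. f z \<le> f x" "\<And>z. f y \<le> f z"
    using circle_Ck_0_attains_max[OF assms] circle_Ck_0_attains_min[OF assms] by metis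
  have "\<bar>f z\<bar> \<le> max \<bar>f x\<bar> \<bar>f y\<bar> + 1" for z
    using *(1)[of z] *(2)[of z] by linarith
  then show thesis by (intro that[of "max \<bar>f x\<bar> \<bar>f y\<bar> + 1"]) auto
qed

lemma circle_Ck_0_pos_lower_bound:
  fixes f :: "real \<Rightarrow> real"
  assumes "circle_Ck 0 f" "\<And>x. f x > 0"
  obtains m where "m > 0" "\<And>x. m \<le> f x"
  using circle_Ck_0_attains_min[OF assms(1)] assms(2) by metis

section \<open>Antiderivatives on the circle and the second-derivative test at a maximum\<close>

lemma continuous_imp_antiderivative:
  fixes f :: "real \<Rightarrow> real"
  assumes "continuous_on UNIV f"
  obtains F where "\<And>x. (F has_real_derivative f x) (at x)"
proof -
  have "\<exists>F. \<forall>x::real. - \<infinity> < ereal x \<longrightarrow> ereal x < \<infinity> \<longrightarrow> (F has_vector_derivative f x) (at x)"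
    using assms by (intro einterval_antiderivative) (auto simp: continuous_on_eq_continuous_at)
  then show thesis
    using that by (auto simp: has_real_derivative_iff_has_vector_derivative)
qed

lemma circle_Ck_0_antiderivative:
  fixes f :: "real \<Rightarrow> real"
  assumes "circle_Ck 0 f"
  obtains F where "\<And>x. (F has_real_derivative f x) (at x)" "\<And>x. F (x + 1) - F x = F 1 - F 0"
proof -
  obtain F where F: "\<And>x. (F has_real_derivative f x) (at x)"
    using continuous_imp_antiderivative assms by (auto simp: circle_Ck_0_iff)
  have "((\<lambda>x. F (x + 1) - F x) has_real_derivative 0) (at x)" for x
  proof -
    have "((\<lambda>x. F (x + 1)) has_real_derivative f (x + 1) * 1) (at x)"
      by (rule DERIV_chain2[OF F]) (auto intro!: derivative_eq_intros)
    with F[of x] show ?thesis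
      using circle_Ck_0_period[OF assms, of x] by (auto intro!: derivative_eq_intros)
  qed
  then have "F (x + 1) - F x = F 1 - F 0" for x
    using DERIV_isconst_all[of "\<lambda>x. F (x + 1) - F x" x 0] by simp
  with F show thesis by (rule that)
qed

text \<open>If f'' were positive at the maximum, f' would be positive just to its right and f would
  rise there.\<close>

lemma second_derivative_at_max:
  fixes f :: "real \<Rightarrow> real"
  assumes f: "\<And>x. (f has_real_derivative f' x) (at x)"
    and f': "(f' has_real_derivative f'') (at x)"
    and e: "e > 0" and max: "\<And>y. \<bar>y - x\<bar> < e \<Longrightarrow> f y \<le> f x"
  shows "f' x = 0" "f'' \<le> 0"
proof -
  show z: "f' x = 0"
    using DERIV_local_max[OF f e] max by (simp add: abs_minus_commute)
  show "f'' \<le> 0"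
  proof (rule ccontr)
    assume "\<not> f'' \<le> 0"
    then obtain d where d: "d > 0" "\<And>h. h > 0 \<Longrightarrow> h < d \<Longrightarrow> f' x < f' (x + h)"
      using DERIV_pos_inc_right[OF f'] by auto
    define h where "h = min d e / 2"
    have h: "h > 0" "h < d" "h < e"
      using d(1) e by (auto simp: h_def min_def)
    have "f x < f (x + h)"
    proof (rule DERIV_pos_imp_increasing_open[of x "x + h" f])
      show "\<exists>z. (f has_real_derivative z) (at y) \<and> z > 0" if "x < y" "y < x + h" for y
        using f[of y] d(2)[of "y - x"] that h z by auto
      show "continuous_on {x..x + h} f"
        using f by (intro DERIV_continuous_on[of _ f f']) (auto intro: has_field_derivative_at_within)
    qed (use h in simp)
    with max[of "x + h"] h show False by simp
  qed
qed

section \<open>A factored second-order operator\<close>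

text \<open>An integrating factor solves v' + Q v = g; periodicity fixes the free constant because
  the mean of Q is positive.\<close>

lemma first_order_periodic_solution:
  fixes Q g :: "real \<Rightarrow> real"
  assumes Q: "circle_Ck 0 Q" "\<And>x. Q x > 0" and g: "circle_Ck 0 g"
  obtains v where "circle_Ck 0 v" "\<And>x. (v has_real_derivative g x - Q x * v x) (at x)"
proof -
  obtain J where J: "\<And>x. (J has_real_derivative Q x) (at x)" "\<And>x. J (x + 1) - J x = J 1 - J 0"
    using circle_Ck_0_antiderivative[OF Q(1)] by blast
  define T where "T = J 1 - J 0"
  have JT: "J (x + 1) = J x + T" for x
    using J(2)[of x] by (simp add: T_def)
  have "J 0 < J 1"
    using J(1) Q(2) by (intro DERIV_pos_imp_increasing[of 0 1 J]) auto
  then have T: "exp T \<noteq> 1" by (simp add: T_def)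
  have "continuous_on UNIV (\<lambda>x. exp (J x) * g x)"
    using circle_Ck_0_isCont[OF g] DERIV_isCont[OF J(1)]
    by (auto simp: continuous_on_eq_continuous_at intro!: continuous_intros)
  then obtain G where G: "\<And>x. (G has_real_derivative exp (J x) * g x) (at x)"
    using continuous_imp_antiderivative by blast
  define k where "k = G 1 - exp T * G 0"
  have "((\<lambda>x. G (x + 1) - exp T * G x) has_real_derivative 0) (at x)" for x
  proof -
    have "((\<lambda>x. G (x + 1)) has_real_derivative exp (J (x + 1)) * g (x + 1) * 1) (at x)"
      by (rule DERIV_chain2[OF G]) (auto intro!: derivative_eq_intros)
    with G[of x] show ?thesis
      using circle_Ck_0_period[OF g, of x] JT[of x]
      by (auto intro!: derivative_eq_intros simp: exp_add)
  qed
  then have Gk: "G (x + 1) = exp T * G x + k" for x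
    using DERIV_isconst_all[of "\<lambda>x. G (x + 1) - exp T * G x" x 0] by (simp add: k_def)
  \<comment> \<open>The added constant s = k / (exp T - 1) solves k + s = exp T * s, so
    \<open>G\<close> plus s is multiplied by \<open>exp T\<close> over a period, which
    \<open>exp (- J x)\<close> undoes.\<close>
  define v where "v x = exp (- J x) * (G x + k / (exp T - 1))" for x
  have der: "(v has_real_derivative g x - Q x * v x) (at x)" for x
  proof -
    have "(v has_real_derivative
        exp (- J x) * (- Q x) * (G x + k / (exp T - 1)) + exp (- J x) * (exp (J x) * g x)) (at x)"
      unfolding v_def using J(1)[of x] G[of x] by (auto intro!: derivative_eq_intros)
    moreover have "exp (- J x) * (- Q x) * (G x + k / (exp T - 1)) + exp (- J x) * (exp (J x) * g x)
        = g x - Q x * v x"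
      by (simp add: v_def exp_minus)
    ultimately show ?thesis by (simp only:)
  qed
  have "v (x + 1) = v x" for x
  proof -
    have "exp T * G x + k + k / (exp T - 1) = exp T * (G x + k / (exp T - 1))"
      using T by (simp add: field_simps)
    then have "v (x + 1) = exp (- J x) * (exp (- T) * (exp T * (G x + k / (exp T - 1))))"
      by (simp add: v_def JT Gk exp_diff exp_minus divide_inverse)
    then show ?thesis
      by (simp add: v_def exp_minus)
  qed
  moreover have "continuous_on UNIV v"
    using der DERIV_isCont by (auto simp: continuous_on_eq_continuous_at)
  ultimately show thesis
    using that der by (auto simp: circle_Ck_0_iff)
qed

text \<open>At a minimum of v the derivative vanishes, so Q v = g >= 0 there.\<close>

lemma first_order_nonneg:
  fixes Q g :: "real \<Rightarrow> real"
  assumes Q: "\<And>x. Q x > 0" and v: "circle_Ck 0 v"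
    and der: "\<And>x. (v has_real_derivative g x - Q x * v x) (at x)"
    and g: "\<And>x. g x \<ge> 0"
  shows "v x \<ge> 0"
proof -
  obtain y where y: "\<And>z. v y \<le> v z"
    using circle_Ck_0_attains_min[OF v] by blast
  have "g y - Q y * v y = 0"
    using DERIV_local_min[OF der, of 1 y] y by simp
  then have "Q y * v y \<ge> 0" using g[of y] by simp
  with Q[of y] have "v y \<ge> 0" by (simp add: zero_le_mult_iff)
  with y[of x] show ?thesis by simp
qed

text \<open>With J' = Q, the product exp J v is nonnegative and nondecreasing, so one zero of v
  forces zeros everywhere to its left and, by periodicity, everywhere. Then g would vanish
  too.\<close>

lemma first_order_pos:
  fixes Q g :: "real \<Rightarrow> real"
  assumes Q: "circle_Ck 0 Q" "\<And>x. Q x > 0" and v: "circle_Ck 0 v"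
    and der: "\<And>x. (v has_real_derivative g x - Q x * v x) (at x)"
    and g: "\<And>x. g x \<ge> 0" "g x\<^sub>0 > 0"
  shows "v x > 0"
proof (rule ccontr)
  assume "\<not> v x > 0"
  have nn: "v y \<ge> 0" for y
    by (rule first_order_nonneg[OF Q(2) v der g(1)])
  with \<open>\<not> v x > 0\<close> have x: "v x = 0"
    by (metis order_le_less)
  obtain J where J: "\<And>x. (J has_real_derivative Q x) (at x)"
    using circle_Ck_0_antiderivative[OF Q(1)] by metis
  have derJ: "((\<lambda>x. exp (J x) * v x) has_real_derivative exp (J y) * g y) (at y)" for y
    using J[of y] der[of y] by (auto intro!: derivative_eq_intros simp: algebra_simps)
  have zero_left: "v y = 0" if "y \<le> x" for y
  proof -
    have "exp (J y) * v y \<le> exp (J x) * v x"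
      by (rule DERIV_nonneg_imp_nondecreasing[of y x "\<lambda>x. exp (J x) * v x"])
        (use that derJ g(1) in \<open>auto intro!: exI\<close>)
    with x nn[of y] show ?thesis by (simp add: mult_le_0_iff)
  qed
  have zero: "v y = 0" for y
  proof -
    obtain n :: nat where "y - x \<le> of_nat n"
      using real_arch_simple by blast
    then show ?thesis
      using zero_left[of "y - of_nat n"] circle_Ck_0_minus_of_int[OF v, of y "int n"] by simp
  qed
  then have "v = (\<lambda>_. 0)" by auto
  then have "g x\<^sub>0 - Q x\<^sub>0 * v x\<^sub>0 = 0"
    using der[of x\<^sub>0] DERIV_unique[OF _ DERIV_const] by metis
  with zero g(2) show False by simp
qed

text \<open>
  With \<open>D = d/dx\<close> the operator \<open>p (p + B) - D\<^sup>2 - B D\<close> factors as \<open>(p + B + D) (p - D)\<close>.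
  The relation says that \<open>w\<close> is the periodic solution of \<open>(p + B + D) (p - D) w = g\<close>.
\<close>

definition factored_solution :: "real \<Rightarrow> (real \<Rightarrow> real) \<Rightarrow> (real \<Rightarrow> real) \<Rightarrow> (real \<Rightarrow> real) \<Rightarrow> bool" where
  "factored_solution p B g w \<longleftrightarrow>
     circle_Ck 0 w \<and>
     (\<exists>v. circle_Ck 0 v \<and>
        (\<forall>x. (w has_real_derivative p * w x - v x) (at x)) \<and>
        (\<forall>x. (v has_real_derivative g x - (p + B x) * v x) (at x)))"

lemma factored_solution_circle_Ck_0: "factored_solution p B g w \<Longrightarrow> circle_Ck 0 w"
  by (simp add: factored_solution_def)

lemma factored_solution_derivatives:
  assumes "factored_solution p B g w"
  obtains w' where "\<And>x. (w has_real_derivative w' x) (at x)"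
    "\<And>x. (w' has_real_derivative p * (p + B x) * w x - B x * w' x - g x) (at x)"
proof -
  obtain v where v: "\<And>x. (w has_real_derivative p * w x - v x) (at x)"
      "\<And>x. (v has_real_derivative g x - (p + B x) * v x) (at x)"
    using assms by (auto simp: factored_solution_def)
  have "((\<lambda>x. p * w x - v x) has_real_derivative
          p * (p + B x) * w x - B x * (p * w x - v x) - g x) (at x)" for x
    using v[of x] by (auto intro!: derivative_eq_intros simp: algebra_simps)
  with v(1) show thesis by (rule that)
qed

lemma factored_solution_linear:
  assumes "factored_solution p B g\<^sub>1 w\<^sub>1" "factored_solution p B g\<^sub>2 w\<^sub>2"
  shows "factored_solution p B (\<lambda>x. g\<^sub>1 x + k * g\<^sub>2 x) (\<lambda>x. w\<^sub>1 x + k * w\<^sub>2 x)"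
proof -
  obtain v\<^sub>1 where v1: "circle_Ck 0 v\<^sub>1" "\<And>x. (w\<^sub>1 has_real_derivative p * w\<^sub>1 x - v\<^sub>1 x) (at x)"
      "\<And>x. (v\<^sub>1 has_real_derivative g\<^sub>1 x - (p + B x) * v\<^sub>1 x) (at x)"
    using assms(1) by (auto simp: factored_solution_def)
  obtain v\<^sub>2 where v2: "circle_Ck 0 v\<^sub>2" "\<And>x. (w\<^sub>2 has_real_derivative p * w\<^sub>2 x - v\<^sub>2 x) (at x)"
      "\<And>x. (v\<^sub>2 has_real_derivative g\<^sub>2 x - (p + B x) * v\<^sub>2 x) (at x)"
    using assms(2) by (auto simp: factored_solution_def)
  have "((\<lambda>x. w\<^sub>1 x + k * w\<^sub>2 x) has_real_derivative
          p * (w\<^sub>1 x + k * w\<^sub>2 x) - (v\<^sub>1 x + k * v\<^sub>2 x)) (at x)"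
    "((\<lambda>x. v\<^sub>1 x + k * v\<^sub>2 x) has_real_derivative
          (g\<^sub>1 x + k * g\<^sub>2 x) - (p + B x) * (v\<^sub>1 x + k * v\<^sub>2 x)) (at x)" for x
    using v1(2,3)[of x] v2(2,3)[of x] by (auto intro!: derivative_eq_intros simp: algebra_simps)
  then show ?thesis
    using assms v1(1) v2(1) unfolding factored_solution_def
    by (intro conjI exI[of _ "\<lambda>x. v\<^sub>1 x + k * v\<^sub>2 x"] allI circle_Ck_0_intros) auto
qed

lemma factored_solution_diff:
  assumes "factored_solution p B g\<^sub>1 w\<^sub>1" "factored_solution p B g\<^sub>2 w\<^sub>2"
  shows "factored_solution p B (\<lambda>x. g\<^sub>1 x - g\<^sub>2 x) (\<lambda>x. w\<^sub>1 x - w\<^sub>2 x)"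
  using factored_solution_linear[OF assms, of "-1"] by simp

lemma factored_solution_scale:
  assumes "factored_solution p B g w"
  shows "factored_solution p B (\<lambda>x. k * g x) (\<lambda>x. k * w x)"
  using factored_solution_linear[OF factored_solution_diff[OF assms assms] assms, of k] by simp

lemma DERIV_reflect:
  fixes w :: "real \<Rightarrow> real"
  assumes "(w has_real_derivative d) (at (- x))"
  shows "((\<lambda>x. w (- x)) has_real_derivative - d) (at x)"
proof -
  have "((\<lambda>x. w (- x)) has_real_derivative d * - 1) (at x)"
    using assms by (rule DERIV_chain2) (auto intro!: derivative_eq_intros)
  then show ?thesis by simp
qed

section \<open>Solvability, positivity and compactness for the factored operator\<close>

context
  fixes p :: real and B :: "real \<Rightarrow> real"
  assumes B: "circle_Ck 0 B" and p: "p > 0" and pB: "\<And>x. p + B x > 0"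
begin

text \<open>The factor p - D gives w' = p w - v, with the sign opposite to that of
  \<open>first_order_periodic_solution\<close>; the reflection x -> - x repairs this.\<close>

lemma factored_solution_exists:
  assumes "circle_Ck 0 g"
  obtains w where "factored_solution p B g w"
proof -
  have "circle_Ck 0 (\<lambda>x. p + B x)" by (intro circle_Ck_0_intros B)
  then obtain v where v: "circle_Ck 0 v" "\<And>x. (v has_real_derivative g x - (p + B x) * v x) (at x)"
    using first_order_periodic_solution pB assms by blast
  obtain w where w: "circle_Ck 0 w" "\<And>x. (w has_real_derivative v (- x) - p * w x) (at x)"
    using first_order_periodic_solution[of "\<lambda>_. p" "\<lambda>x. v (- x)"] p v(1)
    by (auto intro: circle_Ck_0_const circle_Ck_0_reflect)
  have "((\<lambda>x. w (- x)) has_real_derivative p * w (- x) - v x) (at x)" for x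
    using DERIV_reflect[OF w(2)[of "- x"]] by simp
  then have "factored_solution p B g (\<lambda>x. w (- x))"
    using v w(1) by (auto simp: factored_solution_def intro: circle_Ck_0_reflect)
  then show thesis by (rule that)
qed

text \<open>Each first-order factor preserves nonnegativity, the second one again after
  reflection.\<close>

lemma factored_solution_nonneg:
  assumes "factored_solution p B g w" "\<And>x. g x \<ge> 0"
  shows "w x \<ge> 0"
proof -
  obtain v where v: "circle_Ck 0 v" "\<And>x. (w has_real_derivative p * w x - v x) (at x)"
      "\<And>x. (v has_real_derivative g x - (p + B x) * v x) (at x)" and w: "circle_Ck 0 w"
    using assms(1) by (auto simp: factored_solution_def)
  have nn: "v x \<ge> 0" for x
    by (rule first_order_nonneg[OF pB v(1,3) assms(2)])
  have *: "((\<lambda>x. w (- x)) has_real_derivative v (- x) - p * w (- x)) (at x)" for x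
    using DERIV_reflect[OF v(2)[of "- x"]] by simp
  show ?thesis
    using first_order_nonneg[OF p circle_Ck_0_reflect[OF w] * nn, of "- x"] by simp
qed

lemma factored_solution_pos:
  assumes "factored_solution p B g w" "\<And>x. g x \<ge> 0" "g x\<^sub>0 > 0"
  shows "w x > 0"
proof -
  obtain v where v: "circle_Ck 0 v" "\<And>x. (w has_real_derivative p * w x - v x) (at x)"
      "\<And>x. (v has_real_derivative g x - (p + B x) * v x) (at x)" and w: "circle_Ck 0 w"
    using assms(1) by (auto simp: factored_solution_def)
  have pos: "v x > 0" for x
    by (rule first_order_pos[OF _ pB v(1,3) assms(2,3)]) (intro circle_Ck_0_intros B)
  have *: "((\<lambda>x. w (- x)) has_real_derivative v (- x) - p * w (- x)) (at x)" for x
    using DERIV_reflect[OF v(2)[of "- x"]] by simp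
  show ?thesis
    using first_order_pos[OF circle_Ck_0_const p circle_Ck_0_reflect[OF w] *
        less_imp_le[OF pos] pos, of "- x"] by simp
qed

text \<open>Multiples of this explicit solution are the barriers for the sup bound on w
  below.\<close>

lemma factored_solution_const: "factored_solution p B (\<lambda>x. p * (p + B x)) (\<lambda>x. 1)"
  unfolding factored_solution_def
  by (intro conjI exI[of _ "\<lambda>x. p"]) (auto intro!: circle_Ck_0_const derivative_eq_intros simp: mult.commute)

text \<open>Compactness in quantitative form: K does not depend on g. Comparison with constants
  gives |v| <= M / m and |w| <= M / (p m), hence |w'| = |p w - v| <= 2 M / m. K adds the two
  factors, so that it serves as sup bound and as Lipschitz constant.\<close>

lemma factored_solution_bounds:
  obtains K where "K > 0"
    "\<And>g w M. factored_solution p B g w \<Longrightarrow> (\<And>x. \<bar>g x\<bar> \<le> M) \<Longrightarrow>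
       (\<forall>x. \<bar>w x\<bar> \<le> K * M) \<and> (\<forall>x y. \<bar>w x - w y\<bar> \<le> K * M * \<bar>x - y\<bar>)"
proof -
  obtain m where m: "m > 0" "\<And>x. m \<le> p + B x"
    using circle_Ck_0_pos_lower_bound[OF circle_Ck_0_add[OF circle_Ck_0_const B] pB] by blast
  define K where "K = 1 / (p * m) + 2 / m"
  have K: "K > 0" using p m(1) by (simp add: K_def add_pos_pos)
  show thesis
  proof (rule that[OF K])
    fix g w :: "real \<Rightarrow> real" and M :: real
    assume gw: "factored_solution p B g w" and gM: "\<And>x. \<bar>g x\<bar> \<le> M"
    have M: "M \<ge> 0" using gM[of 0] by linarith
    obtain v where v: "circle_Ck 0 v" "\<And>x. (w has_real_derivative p * w x - v x) (at x)"
        "\<And>x. (v has_real_derivative g x - (p + B x) * v x) (at x)" and w: "circle_Ck 0 w"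
      using gw by (auto simp: factored_solution_def)
    have vb: "\<bar>v x\<bar> \<le> M / m" for x
    proof -
      have MB: "M \<le> (p + B x) * (M / m)" for x
        using mult_right_mono[OF m(2)[of x], of "M / m"] M m(1) by simp
      have "0 \<le> M / m - v x"
      proof (rule first_order_nonneg[OF pB, of "\<lambda>x. M / m - v x" "\<lambda>x. (p + B x) * (M / m) - g x"])
        show "circle_Ck 0 (\<lambda>x. M / m - v x)" by (rule circle_Ck_0_diff[OF circle_Ck_0_const v(1)])
        show "((\<lambda>x. M / m - v x) has_real_derivative
            (p + B x) * (M / m) - g x - (p + B x) * (M / m - v x)) (at x)" for x
          using v(3)[of x] by (auto intro!: derivative_eq_intros simp: algebra_simps)
        show "0 \<le> (p + B x) * (M / m) - g x" for x
          using MB[of x] gM[of x] by linarith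
      qed
      moreover have "0 \<le> M / m + v x"
      proof (rule first_order_nonneg[OF pB, of "\<lambda>x. M / m + v x" "\<lambda>x. (p + B x) * (M / m) + g x"])
        show "circle_Ck 0 (\<lambda>x. M / m + v x)" by (rule circle_Ck_0_add[OF circle_Ck_0_const v(1)])
        show "((\<lambda>x. M / m + v x) has_real_derivative
            (p + B x) * (M / m) + g x - (p + B x) * (M / m + v x)) (at x)" for x
          using v(3)[of x] by (auto intro!: derivative_eq_intros simp: algebra_simps)
        show "0 \<le> (p + B x) * (M / m) + g x" for x
          using MB[of x] gM[of x] by linarith
      qed
      ultimately show ?thesis by linarith
    qed
    have wb: "\<bar>w x\<bar> \<le> M / (p * m)" for x
    proof -
      have MB: "M \<le> (p + B x) * (M / m)" for x
        using mult_right_mono[OF m(2)[of x], of "M / m"] M m(1) by simp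
      have E: "(M / (p * m)) * (p * (p + B x)) = (p + B x) * (M / m)" for x
        using p by simp
      have "factored_solution p B (\<lambda>x. g x + (M / (p * m)) * (p * (p + B x))) (\<lambda>x. w x + (M / (p * m)) * 1)"
        by (rule factored_solution_linear[OF gw factored_solution_const])
      moreover have "g x + (M / (p * m)) * (p * (p + B x)) \<ge> 0" for x
        unfolding E using MB[of x] gM[of x] by linarith
      ultimately have 1: "w x + (M / (p * m)) * 1 \<ge> 0"
        by (rule factored_solution_nonneg)
      have "factored_solution p B (\<lambda>x. (M / (p * m)) * (p * (p + B x)) - g x) (\<lambda>x. (M / (p * m)) * 1 - w x)"
        by (intro factored_solution_diff factored_solution_scale factored_solution_const gw)
      moreover have "(M / (p * m)) * (p * (p + B x)) - g x \<ge> 0" for x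
        unfolding E using MB[of x] gM[of x] by linarith
      ultimately have "(M / (p * m)) * 1 - w x \<ge> 0"
        by (rule factored_solution_nonneg)
      with 1 show ?thesis by linarith
    qed
    have db2: "\<bar>p * w x - v x\<bar> \<le> 2 / m * M" for x
    proof -
      have "p * \<bar>w x\<bar> \<le> p * (M / (p * m))"
        using wb[of x] p by (intro mult_left_mono) auto
      then have "\<bar>p * w x\<bar> \<le> M / m" using p by (simp add: abs_mult)
      with vb[of x] show ?thesis by (simp add: abs_le_iff)
    qed
    have KM: "K * M = M / (p * m) + 2 / m * M"
      by (simp add: K_def distrib_right)
    have nn: "0 \<le> M / (p * m)" "0 \<le> 2 / m * M"
      using M p m(1) by auto
    have db: "\<bar>p * w x - v x\<bar> \<le> K * M" for x
      using db2[of x] KM nn by linarith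
    have wKM: "\<bar>w x\<bar> \<le> K * M" for x
      using wb[of x] KM nn by linarith
    have "\<bar>w x - w y\<bar> \<le> K * M * \<bar>x - y\<bar>" for x y
      using field_differentiable_bound[of UNIV w "\<lambda>x. p * w x - v x" "K * M" x y] v(2) db
      by (auto simp: real_norm_def)
    with wKM show "(\<forall>x. \<bar>w x\<bar> \<le> K * M) \<and> (\<forall>x y. \<bar>w x - w y\<bar> \<le> K * M * \<bar>x - y\<bar>)"
      by blast
  qed
qed

end

section \<open>Existence of a positive eigenfunction\<close>

text \<open>Arzela-Ascoli on one period; periodicity spreads the uniform convergence over the
  line.\<close>

lemma periodic_uniform_limit_subsequence:
  fixes w :: "nat \<Rightarrow> real \<Rightarrow> real"
  assumes w: "\<And>n. circle_Ck 0 (w n)" and M: "\<And>n x. \<bar>w n x\<bar> \<le> M"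
    and lip: "\<And>n x y. \<bar>w n x - w n y\<bar> \<le> L * \<bar>x - y\<bar>"
  obtains v r where "circle_Ck 0 v" "strict_mono (r :: nat \<Rightarrow> nat)"
    "\<And>e. e > 0 \<Longrightarrow> \<exists>N. \<forall>n\<ge>N. \<forall>x. \<bar>w (r n) x - v x\<bar> < e"
proof -
  have "\<exists>d>0. \<forall>n y. y \<in> {0..1} \<and> norm (x - y) < d \<longrightarrow> norm (w n x - w n y) < e"
    if "e > 0" for x e :: real
  proof (intro exI conjI allI impI)
    show "0 < e / (\<bar>L\<bar> + 1)" using that by simp
    fix n y assume "y \<in> {0..1} \<and> norm (x - y) < e / (\<bar>L\<bar> + 1)"
    then have "(\<bar>L\<bar> + 1) * \<bar>x - y\<bar> < e"
      by (simp add: field_simps)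
    moreover have "L * \<bar>x - y\<bar> \<le> (\<bar>L\<bar> + 1) * \<bar>x - y\<bar>"
      by (intro mult_right_mono) auto
    ultimately show "norm (w n x - w n y) < e"
      using lip[of n x y] by simp
  qed
  then obtain g r where r: "strict_mono (r :: nat \<Rightarrow> nat)"
    and g: "\<And>e. 0 < e \<Longrightarrow> \<exists>N. \<forall>n x. n \<ge> N \<and> x \<in> {0..1} \<longrightarrow> norm (w (r n) x - g x) < e"
    using Arzela_Ascoli[of "{0..1::real}" w M] M by (metis compact_Icc real_norm_def)
  \<comment> \<open>Extension by \<open>frac\<close> could create a jump at the integers; uniform
    convergence on the whole line excludes it.\<close>
  define v where "v x = g (frac x)" for x
  have unif: "\<exists>N. \<forall>n\<ge>N. \<forall>x. \<bar>w (r n) x - v x\<bar> < e" if "e > 0" for e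
  proof -
    obtain N where N: "\<And>n x. n \<ge> N \<Longrightarrow> x \<in> {0..1} \<Longrightarrow> norm (w (r n) x - g x) < e"
      using g \<open>e > 0\<close> by blast
    have "\<bar>w (r n) x - v x\<bar> < e" if "n \<ge> N" for n x
      using N[OF that, of "frac x"] circle_Ck_0_frac[OF w, of "r n" x]
      by (simp add: v_def frac_ge_0 less_imp_le[OF frac_lt_1])
    then show ?thesis by blast
  qed
  have "uniform_limit UNIV (\<lambda>n. w (r n)) v sequentially"
    using unif by (auto simp: uniform_limit_sequentially_iff dist_real_def)
  then have "continuous_on UNIV v"
    by (rule uniform_limit_theorem[rotated]) (use w in \<open>auto simp: circle_Ck_0_iff\<close>)
  moreover have "v (x + 1) = v x" for x
    by (simp add: v_def frac_1_eq)
  ultimately have "circle_Ck 0 v"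
    by (simp add: circle_Ck_0_iff)
  then show thesis using that r unif by blast
qed

text \<open>A Collatz-Wielandt argument. With R the inverse of the factored operator, the equation
  reads w = R (h \<mu> w), and \<mu> is the largest number for which some nonzero u >= 0 satisfies u
  <= R (h \<mu> u). Compactness shows that the supremum is attained; strict positivity of R forces
  equality there, since a gap would leave room to raise \<mu>.\<close>

theorem positive_periodic_eigenfunction:
  fixes A B C :: "real \<Rightarrow> real"
  assumes A: "circle_Ck 0 A" "\<And>x. A x > 0" and B: "circle_Ck 0 B" and C: "circle_Ck 0 C"
  obtains \<mu> w w' where "circle_Ck 0 w" "\<And>x. w x > 0"
    "\<And>x. (w has_real_derivative w' x) (at x)"
    "\<And>x. (w' has_real_derivative \<mu> * A x * w x - B x * w' x - C x * w x) (at x)"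
proof -
  obtain Am where Am: "Am > 0" "\<And>x. Am \<le> A x"
    using circle_Ck_0_pos_lower_bound[OF A] by blast
  obtain AM where AM: "AM > 0" "\<And>x. \<bar>A x\<bar> \<le> AM"
    using circle_Ck_0_bounded[OF A(1)] by blast
  obtain c\<^sub>0 where c0: "c\<^sub>0 > 0" "\<And>x. \<bar>C x\<bar> \<le> c\<^sub>0"
    using circle_Ck_0_bounded[OF C] by blast
  obtain b\<^sub>0 where b0: "b\<^sub>0 > 0" "\<And>x. \<bar>B x\<bar> \<le> b\<^sub>0"
    using circle_Ck_0_bounded[OF B] by blast
  \<comment> \<open>\<open>l\<close> bounds |C / A|: the value - l is admissible with u = 1, and the
    maximum principle excludes values above l.\<close>
  define l where "l = c\<^sub>0 / Am"
  have l: "l > 0" using c0(1) Am(1) by (simp add: l_def)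
  \<comment> \<open>Large enough for p >= 1 and for \<open>h \<mu>\<close> to be positive for all
    \<mu> up to l + 1. The extra 1 leaves room for moving beyond the supremum at the end.\<close>
  define p where "p = b\<^sub>0 + 1 + c\<^sub>0 + (l + 1) * AM"
  have lAM: "(l + 1) * AM > 0" using l AM(1) by simp
  have p1: "p \<ge> 1" using b0(1) c0(1) lAM by (simp add: p_def)
  then have p: "p > 0" by simp
  have pB1: "p + B x \<ge> 1 + c\<^sub>0 + (l + 1) * AM" for x
    using b0(2)[of x] by (simp add: p_def abs_le_iff)
  then have pB: "p + B x > 0" for x
    using lAM c0(1) by (smt (verit))
  define h where "h \<mu> x = p * (p + B x) + C x - \<mu> * A x" for \<mu> x
  have hC: "circle_Ck 0 (h \<mu>)" for \<mu>
    unfolding h_def by (intro circle_Ck_0_intros A(1) B C)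
  have hpos: "h \<mu> x > 0" if "\<mu> \<le> l + 1" for \<mu> x
  proof -
    have "\<mu> * A x \<le> (l + 1) * A x"
      using that A(2)[of x] by (intro mult_right_mono) auto
    also have "\<dots> \<le> (l + 1) * AM"
      using AM(2)[of x] l by (intro mult_left_mono) auto
    finally have "\<mu> * A x \<le> (l + 1) * AM" .
    moreover have "1 * (p + B x) \<le> p * (p + B x)"
      using p1 pB[of x] by (intro mult_right_mono) auto
    ultimately show ?thesis
      using pB1[of x] c0(2)[of x] by (simp add: h_def abs_le_iff)
  qed
  let ?sol = "factored_solution p B"
  note exists = factored_solution_exists[OF B p pB]
  \<comment> \<open>Here \<open>w\<close> is R (h \<mu> u), so \<open>u x \<le> w x\<close> is the
    subsolution inequality for a merely continuous u.\<close>
  define sub where "sub \<mu> u w \<longleftrightarrow> circle_Ck 0 u \<and> (\<forall>x. 0 \<le> u x) \<and> (\<exists>x. u x > 0) \<and>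
    ?sol (\<lambda>x. h \<mu> x * u x) w \<and> (\<forall>x. u x \<le> w x)" for \<mu> and u w :: "real \<Rightarrow> real"
  define S where "S = {\<mu>. \<mu> \<le> l + 1 \<and> (\<exists>u w. sub \<mu> u w)}"
  have "- l \<in> S"
  proof -
    obtain w where w: "?sol (h (- l)) w" using exists[OF hC] .
    have "?sol (\<lambda>x. h (- l) x - p * (p + B x)) (\<lambda>x. w x - 1)"
      by (rule factored_solution_diff[OF w factored_solution_const[OF B p pB]])
    moreover have "h (- l) x - p * (p + B x) \<ge> 0" for x
    proof -
      have "c\<^sub>0 = l * Am" using Am(1) by (simp add: l_def)
      also have "\<dots> \<le> l * A x" using Am(2)[of x] l by (intro mult_left_mono) auto
      finally show ?thesis using c0(2)[of x] by (simp add: h_def abs_le_iff)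
    qed
    ultimately have "w x - 1 \<ge> 0" for x
      by (rule factored_solution_nonneg[OF B p pB])
    then have "sub (- l) (\<lambda>_. 1) w"
      using w by (simp add: sub_def circle_Ck_0_const)
    then show ?thesis using l by (auto simp: S_def)
  qed
  \<comment> \<open>Since u has no derivatives, the maximum principle is applied to w; positivity of
    h then replaces u by the larger w.\<close>
  have S_le: "\<mu> \<le> l" if \<mu>S: "\<mu> \<in> S" for \<mu>
  proof -
    obtain u w where uw: "sub \<mu> u w" and l1: "\<mu> \<le> l + 1"
      using \<mu>S by (auto simp: S_def)
    then have sol: "?sol (\<lambda>x. h \<mu> x * u x) w" by (simp add: sub_def)
    obtain x where x: "\<And>y. w y \<le> w x"
      using circle_Ck_0_attains_max[OF factored_solution_circle_Ck_0[OF sol]] by blast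
    obtain w' where w': "\<And>x. (w has_real_derivative w' x) (at x)"
      "\<And>x. (w' has_real_derivative p * (p + B x) * w x - B x * w' x - h \<mu> x * u x) (at x)"
      using factored_solution_derivatives[OF sol] by blast
    have "w' x = 0" "p * (p + B x) * w x - B x * w' x - h \<mu> x * u x \<le> 0"
      using second_derivative_at_max[OF w'(1) w'(2), of 1 x] x by auto
    then have "p * (p + B x) * w x \<le> h \<mu> x * u x" by simp
    also have "\<dots> \<le> h \<mu> x * w x"
      using uw hpos[OF l1, of x] by (intro mult_left_mono) (auto simp: sub_def)
    finally have "\<mu> * A x * w x \<le> C x * w x"
      by (simp add: h_def algebra_simps)
    moreover have "w x > 0"
      using uw x by (auto simp: sub_def) (meson less_le_trans)
    ultimately have "\<mu> * A x \<le> C x" by simp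
    then have "\<mu> \<le> C x / A x" using A(2)[of x] by (simp add: field_simps)
    also have "\<dots> \<le> c\<^sub>0 / Am"
      using c0 Am A(2)[of x] by (intro frac_le) (auto simp: abs_le_iff)
    finally show ?thesis by (simp add: l_def)
  qed
  define ls where "ls = Sup S"
  have bdd: "bdd_above S" using S_le by (auto simp: bdd_above_def)
  have lsl: "ls \<le> l"
    unfolding ls_def using \<open>- l \<in> S\<close> S_le by (intro cSup_least) auto
  \<comment> \<open>Near-maximisers, normalised to maximum 1 so that the limit cannot
    vanish.\<close>
  have "\<exists>\<mu> u w. \<mu> \<le> ls \<and> ls - 1 / Suc n < \<mu> \<and> sub \<mu> u w \<and> (\<forall>x. u x \<le> 1) \<and> (\<exists>x. u x = 1)" for n :: nat
  proof -
    obtain \<mu> where \<mu>: "\<mu> \<in> S" "ls - 1 / Suc n < \<mu>"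
      using less_cSup_iff[of S "ls - 1 / Suc n"] bdd \<open>- l \<in> S\<close> by (auto simp: ls_def)
    then obtain u w where uw: "sub \<mu> u w" by (auto simp: S_def)
    obtain y where y: "\<And>x. u x \<le> u y"
      using circle_Ck_0_attains_max[of u] uw unfolding sub_def by metis
    have uy: "u y > 0"
      using uw y by (auto simp: sub_def) (meson less_le_trans)
    have "?sol (\<lambda>x. 1 / u y * (h \<mu> x * u x)) (\<lambda>x. 1 / u y * w x)"
      using uw by (intro factored_solution_scale) (auto simp: sub_def)
    then have "sub \<mu> (\<lambda>x. 1 / u y * u x) (\<lambda>x. 1 / u y * w x)"
      using uw uy unfolding sub_def
      by (intro conjI circle_Ck_0_mult circle_Ck_0_const)
        (auto simp: mult.left_commute divide_right_mono intro!: exI[of _ y])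
    moreover have "\<mu> \<le> ls"
      unfolding ls_def by (rule cSup_upper[OF \<mu>(1) bdd])
    ultimately show ?thesis
      using \<mu>(2) y uy by (intro exI[of _ \<mu>] exI[of _ "\<lambda>x. 1 / u y * u x"] exI[of _ "\<lambda>x. 1 / u y * w x"])
        (auto intro!: exI[of _ y])
  qed
  then obtain \<Lambda> u w where seq: "\<And>n. \<Lambda> n \<le> ls" "\<And>n::nat. ls - 1 / Suc n < \<Lambda> n"
      "\<And>n. sub (\<Lambda> n) (u n) (w n)" "\<And>n x. u n x \<le> 1" "\<And>n. \<exists>x. u n x = 1"
    by metis
  obtain K where K: "K > 0"
    "\<And>g w M. ?sol g w \<Longrightarrow> (\<And>x. \<bar>g x\<bar> \<le> M) \<Longrightarrow>
       (\<forall>x. \<bar>w x\<bar> \<le> K * M) \<and> (\<forall>x y. \<bar>w x - w y\<bar> \<le> K * M * \<bar>x - y\<bar>)"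
    using factored_solution_bounds[OF B p pB] by blast
  obtain Hs where Hs: "Hs > 0" "\<And>x. \<bar>h ls x\<bar> \<le> Hs"
    using circle_Ck_0_bounded[OF hC] by blast
  have h_diff: "\<bar>h (\<Lambda> n) x - h ls x\<bar> \<le> AM / Suc n" for n x
  proof -
    have "\<bar>h (\<Lambda> n) x - h ls x\<bar> = (ls - \<Lambda> n) * A x"
      using seq(1)[of n] A(2)[of x] by (simp add: h_def left_diff_distrib abs_mult algebra_simps mult_right_mono)
    also have "\<dots> \<le> (1 / Suc n) * AM"
      using seq(1,2)[of n] AM A(2)[of x] by (intro mult_mono) (auto simp: abs_le_iff)
    finally show ?thesis by simp
  qed
  have sol: "?sol (\<lambda>x. h (\<Lambda> n) x * u n x) (w n)" for n
    using seq(3)[of n] by (simp add: sub_def)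
  have u0: "0 \<le> u n x" and uw: "u n x \<le> w n x" for n x
    using seq(3)[of n] by (auto simp: sub_def)
  have "\<bar>h (\<Lambda> n) x * u n x\<bar> \<le> Hs + AM" for n x
  proof -
    have "AM / Suc n \<le> AM" using AM(1) by (simp add: field_simps)
    then have "\<bar>h (\<Lambda> n) x\<bar> \<le> Hs + AM"
      using h_diff[of n x] Hs(2)[of x] by linarith
    moreover have "\<bar>u n x\<bar> \<le> 1" using u0[of n x] seq(4)[of n x] by simp
    ultimately have "\<bar>h (\<Lambda> n) x\<bar> * \<bar>u n x\<bar> \<le> (Hs + AM) * 1"
      by (intro mult_mono) auto
    then show ?thesis by (simp add: abs_mult)
  qed
  define M where "M = K * (Hs + AM)"
  have wM: "\<bar>w n x\<bar> \<le> M" and wlip: "\<bar>w n x - w n y\<bar> \<le> M * \<bar>x - y\<bar>" for n x y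
    using K(2)[OF sol \<open>\<And>n x. \<bar>h (\<Lambda> n) x * u n x\<bar> \<le> Hs + AM\<close>] by (auto simp: M_def)
  have M0: "M > 0" using K(1) Hs(1) AM(1) by (simp add: M_def)
  \<comment> \<open>Only the \<open>w n\<close> are equicontinuous, so the limit is taken along them
    rather than along the \<open>u n\<close>.\<close>
  obtain v r where v: "circle_Ck 0 v" and r: "strict_mono (r :: nat \<Rightarrow> nat)"
    and unif: "\<And>e. e > 0 \<Longrightarrow> \<exists>N. \<forall>n\<ge>N. \<forall>x. \<bar>w (r n) x - v x\<bar> < e"
    using periodic_uniform_limit_subsequence[of w M M] wM wlip
      factored_solution_circle_Ck_0[OF sol] by metis
  have approx: "\<exists>n. 1 / Suc n < e \<and> (\<forall>x. \<bar>w n x - v x\<bar> < e)" if e: "e > 0" for e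
  proof -
    obtain N1 where N1: "\<And>n x. n \<ge> N1 \<Longrightarrow> \<bar>w (r n) x - v x\<bar> < e"
      using unif[OF e] by blast
    obtain N2 :: nat where N2: "1 / Suc N2 < e"
      using nat_approx_posE[OF e] by metis
    define n where "n = max N1 N2"
    have "n \<le> r n" by (rule seq_suble[OF r])
    then have "1 / Suc (r n) \<le> 1 / Suc N2"
      by (intro divide_left_mono) (auto simp: n_def)
    with N2 N1[of n] show ?thesis by (intro exI[of _ "r n"]) (auto simp: n_def)
  qed
  have vnn: "v x \<ge> 0" for x
  proof (rule field_le_epsilon)
    fix e :: real assume "e > 0"
    then obtain n where "\<bar>w n x - v x\<bar> < e" using approx by blast
    then show "0 \<le> v x + e" using u0[of n x] uw[of n x] by linarith
  qed
  have "\<exists>x. v x > 0"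
  proof -
    obtain n where n: "\<And>x. \<bar>w n x - v x\<bar> < 1 / 2" using approx[of "1 / 2"] by auto
    obtain x where "u n x = 1" using seq(5) by blast
    with n[of x] uw[of n x] have "v x > 0" by linarith
    then show ?thesis ..
  qed
  then obtain x\<^sub>1 where x1: "v x\<^sub>1 > 0" ..
  obtain z where z: "?sol (\<lambda>x. h ls x * v x) z"
    using exists[OF circle_Ck_0_mult[OF hC v]] .
  \<comment> \<open>\<open>w n\<close> is again a subsolution: u n <= w n and positivity of R give w
    n <= \<open>zn\<close> = R (h w n). The bounds on R carry this inequality to the limit.\<close>
  have zv: "v x \<le> z x" for x
  proof -
    \<comment> \<open>Makes the errors |w n - v| and |zn - z| add up to e.\<close>
    define D where "D = 1 + K * (Hs + AM * M)"
    have D: "D > 0" using K(1) Hs(1) AM(1) M0 by (simp add: D_def add_pos_pos)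
    show ?thesis
    proof (rule field_le_epsilon)
      fix e :: real assume "e > 0"
      then obtain n where n: "1 / Suc n < e / D" "\<And>x. \<bar>w n x - v x\<bar> < e / D"
        using approx[of "e / D"] D by auto
      obtain zn where zn: "?sol (\<lambda>x. h (\<Lambda> n) x * w n x) zn"
        using exists[OF circle_Ck_0_mult[OF hC factored_solution_circle_Ck_0[OF sol]]] .
      have "0 \<le> zn x - w n x"
      proof (rule factored_solution_nonneg[OF B p pB, where w = "\<lambda>x. zn x - w n x"])
        show "?sol (\<lambda>x. h (\<Lambda> n) x * w n x - h (\<Lambda> n) x * u n x) (\<lambda>x. zn x - w n x)"
          by (rule factored_solution_diff[OF zn sol])
        have "\<Lambda> n \<le> l + 1" using seq(1)[of n] lsl by linarith
        then show "0 \<le> h (\<Lambda> n) x * w n x - h (\<Lambda> n) x * u n x" for x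
          using hpos[of "\<Lambda> n" x] uw[of n x] by (simp add: mult_left_mono)
      qed
      moreover have "\<bar>zn x - z x\<bar> \<le> K * ((Hs + AM * M) * (e / D))"
      proof -
        have "?sol (\<lambda>x. h (\<Lambda> n) x * w n x - h ls x * v x) (\<lambda>x. zn x - z x)"
          by (rule factored_solution_diff[OF zn z])
        moreover have "\<bar>h (\<Lambda> n) x * w n x - h ls x * v x\<bar> \<le> (Hs + AM * M) * (e / D)" for x
        proof -
          have "\<bar>h (\<Lambda> n) x * w n x - h ls x * v x\<bar>
              = \<bar>(h (\<Lambda> n) x - h ls x) * w n x + h ls x * (w n x - v x)\<bar>"
            by (simp add: algebra_simps)
          also have "\<dots> \<le> \<bar>h (\<Lambda> n) x - h ls x\<bar> * \<bar>w n x\<bar> + \<bar>h ls x\<bar> * \<bar>w n x - v x\<bar>"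
            by (metis abs_mult abs_triangle_ineq)
          also have "\<dots> \<le> (AM * (e / D)) * M + Hs * (e / D)"
          proof (intro add_mono mult_mono)
            have "AM * (1 / Suc n) \<le> AM * (e / D)"
              using n(1) AM(1) by (intro mult_left_mono) auto
            then show "\<bar>h (\<Lambda> n) x - h ls x\<bar> \<le> AM * (e / D)"
              using h_diff[of n x] by simp
          qed (use wM Hs n(2)[of x] AM \<open>e > 0\<close> D in auto)
          finally show ?thesis by (simp add: algebra_simps)
        qed
        ultimately show ?thesis using K(2) by blast
      qed
      ultimately have "v x \<le> z x + (e / D + K * ((Hs + AM * M) * (e / D)))"
        using n(2)[of x] by linarith
      also have "e / D + K * ((Hs + AM * M) * (e / D)) = D * (e / D)"
        by (simp only: D_def distrib_right mult_1 mult.assoc)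
      also have "\<dots> = e" using D by simp
      finally show "v x \<le> z x + e" .
    qed
  qed
  have ls1: "ls \<le> l + 1" using lsl by simp
  \<comment> \<open>If v < z somewhere, then y = R (h z) exceeds z everywhere, by a margin m.
    Raising \<mu> by d lowers y by d s; the margin absorbs this since d T <= m, and d <= 1 keeps
    \<mu> below l + 1. So z would be a subsolution beyond the supremum.\<close>
  have "z x = v x" for x
  proof (rule ccontr)
    assume "z x \<noteq> v x"
    then have x: "v x < z x" using zv[of x] by simp
    obtain y where y: "?sol (\<lambda>x. h ls x * z x) y"
      using exists[OF circle_Ck_0_mult[OF hC factored_solution_circle_Ck_0[OF z]]] .
    have yz: "?sol (\<lambda>x. h ls x * z x - h ls x * v x) (\<lambda>x. y x - z x)"
      by (rule factored_solution_diff[OF y z])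
    have nn: "h ls x * z x - h ls x * v x \<ge> 0" for x
      using hpos[OF ls1, of x] zv[of x] by (simp add: mult_left_mono)
    have "h ls x * z x - h ls x * v x > 0"
      using hpos[OF ls1, of x] x by simp
    then have "y t - z t > 0" for t
      by (rule factored_solution_pos[OF B p pB yz nn])
    then obtain m where m: "m > 0" "\<And>t. m \<le> y t - z t"
      using circle_Ck_0_pos_lower_bound[OF factored_solution_circle_Ck_0[OF yz]] by blast
    obtain s where s: "?sol (\<lambda>x. A x * z x) s"
      using exists[OF circle_Ck_0_mult[OF A(1) factored_solution_circle_Ck_0[OF z]]] .
    obtain T where T: "T > 0" "\<And>x. \<bar>s x\<bar> \<le> T"
      using circle_Ck_0_bounded[OF factored_solution_circle_Ck_0[OF s]] by blast
    define d where "d = min 1 (m / T)"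
    have d: "d > 0" "d \<le> 1" "d * T \<le> m"
      using m(1) T(1) by (auto simp: d_def min_def field_simps)
    have "?sol (\<lambda>x. h ls x * z x + - d * (A x * z x)) (\<lambda>x. y x + - d * s x)"
      by (rule factored_solution_linear[OF y s])
    moreover have "(\<lambda>x. h ls x * z x + - d * (A x * z x)) = (\<lambda>x. h (ls + d) x * z x)"
      by (auto simp: h_def algebra_simps)
    ultimately have sol': "?sol (\<lambda>x. h (ls + d) x * z x) (\<lambda>x. y x + - d * s x)" by simp
    have "z t \<le> y t + - d * s t" for t
    proof -
      have "d * s t \<le> d * T" using d(1) T(2)[of t] by (intro mult_left_mono) auto
      then show ?thesis using m(2)[of t] d(3) by simp
    qed
    moreover have "0 \<le> z t" for t using vnn[of t] zv[of t] by linarith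
    moreover have "0 < z x\<^sub>1" using x1 zv[of x\<^sub>1] by linarith
    ultimately have "sub (ls + d) z (\<lambda>x. y x + - d * s x)"
      using sol' factored_solution_circle_Ck_0[OF z] by (auto simp: sub_def)
    then have "ls + d \<in> S" using lsl d(2) by (auto simp: S_def)
    then have "ls + d \<le> ls" unfolding ls_def using bdd by (intro cSup_upper)
    with d(1) show False by simp
  qed
  then have "z = v" by auto
  with z have vsol: "?sol (\<lambda>x. h ls x * v x) v" by simp
  have vpos: "v x > 0" for x
  proof (rule factored_solution_pos[OF B p pB vsol])
    show "0 \<le> h ls x * v x" for x using hpos[OF ls1, of x] vnn[of x] by simp
    show "0 < h ls x\<^sub>1 * v x\<^sub>1" using hpos[OF ls1, of x\<^sub>1] x1 by simp
  qed
  obtain v' where v': "\<And>x. (v has_real_derivative v' x) (at x)"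
    "\<And>x. (v' has_real_derivative p * (p + B x) * v x - B x * v' x - h ls x * v x) (at x)"
    using factored_solution_derivatives[OF vsol] by blast
  have "p * (p + B x) * v x - B x * v' x - h ls x * v x = ls * A x * v x - B x * v' x - C x * v x" for x
    by (simp add: h_def algebra_simps)
  then show thesis
    using that[OF v vpos v'(1)] v'(2) by metis
qed

section \<open>Sub- and supersolutions\<close>

text \<open>Nontriviality is left to the users: the upper bound asks for a nonzero value somewhere,
  the lower bound for positivity everywhere. Continuity of u'' follows from the equation when the
  coefficients are continuous and \<alpha> has no zero.\<close>

definition real_eigenfunction ::
  "(real \<Rightarrow> real) \<Rightarrow> (real \<Rightarrow> real) \<Rightarrow> (real \<Rightarrow> real) \<Rightarrow> real \<Rightarrow> (real \<Rightarrow> real) \<Rightarrow> bool" where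
  "real_eigenfunction \<alpha> b c \<mu> u \<longleftrightarrow>
     circle_Ck 0 u \<and>
     (\<exists>u' u''. (\<forall>x. (u has_real_derivative u' x) (at x)) \<and> (\<forall>x. (u' has_real_derivative u'' x) (at x)) \<and>
        (\<forall>x. \<alpha> x * u'' x + b x * u' x + c x * u x = \<mu> * u x))"

text \<open>At x the difference \<phi> - t v has a local maximum with value 0, so the terms of order
  zero and one agree and the second derivatives are ordered; \<beta> and \<gamma> may have any
  sign.\<close>

lemma elliptic_touching:
  fixes \<phi> v :: "real \<Rightarrow> real"
  assumes phi: "\<And>x. (\<phi> has_real_derivative \<phi>' x) (at x)" "\<And>x. (\<phi>' has_real_derivative \<phi>'' x) (at x)"
    and v: "\<And>x. (v has_real_derivative v' x) (at x)" "\<And>x. (v' has_real_derivative v'' x) (at x)"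
    and e: "e > 0" and touch: "\<phi> x = t * v x" "\<And>y. \<bar>y - x\<bar> < e \<Longrightarrow> \<phi> y \<le> t * v y"
    and \<alpha>: "\<alpha> \<ge> 0"
  shows "\<alpha> * \<phi>'' x + \<beta> * \<phi>' x + \<gamma> * \<phi> x \<le> t * (\<alpha> * v'' x + \<beta> * v' x + \<gamma> * v x)"
proof -
  have 1: "((\<lambda>x. \<phi> x - t * v x) has_real_derivative \<phi>' x - t * v' x) (at x)" for x
    using phi(1)[of x] v(1)[of x] by (auto intro!: derivative_eq_intros)
  have 2: "((\<lambda>x. \<phi>' x - t * v' x) has_real_derivative \<phi>'' x - t * v'' x) (at x)" for x
    using phi(2)[of x] v(2)[of x] by (auto intro!: derivative_eq_intros)
  have "\<phi>' x - t * v' x = 0" "\<phi>'' x - t * v'' x \<le> 0"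
    using second_derivative_at_max[OF 1 2 e] touch by simp_all
  moreover from this(2) \<alpha> have "\<alpha> * \<phi>'' x \<le> \<alpha> * (t * v'' x)"
    by (intro mult_left_mono) auto
  ultimately show ?thesis
    using touch(1) by (simp add: algebra_simps)
qed

text \<open>Scale w until it touches u from above, at a maximum of u / w, and compare the two
  operators there.\<close>

lemma eigenvalue_le_supersolution:
  fixes u w :: "real \<Rightarrow> real"
  assumes u: "circle_Ck 0 u" "\<And>x. (u has_real_derivative u' x) (at x)" "\<And>x. (u' has_real_derivative u'' x) (at x)"
    and w: "circle_Ck 0 w" "\<And>x. (w has_real_derivative w' x) (at x)" "\<And>x. (w' has_real_derivative w'' x) (at x)"
    and \<alpha>: "\<And>x. \<alpha> x \<ge> 0" and pos: "\<And>x. w x > 0"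
    and eig: "\<And>x. \<alpha> x * u'' x + b x * u' x + c x * u x = \<mu> * u x"
    and super: "\<And>x. \<alpha> x * w'' x + b x * w' x + c x * w x \<le> \<kappa> * w x"
    and nz: "u x\<^sub>0 \<noteq> 0"
  shows "\<mu> \<le> \<kappa>"
proof -
  \<comment> \<open>The touching factor has to be positive, so u is taken positive somewhere;
    otherwise - u takes its place.\<close>
  have main: "\<mu> \<le> \<kappa>"
    if u: "circle_Ck 0 u" "\<And>x. (u has_real_derivative u' x) (at x)" "\<And>x. (u' has_real_derivative u'' x) (at x)"
      and eig: "\<And>x. \<alpha> x * u'' x + b x * u' x + c x * u x = \<mu> * u x"
      and nz: "u x\<^sub>0 > 0" for u u' u'' :: "real \<Rightarrow> real"
  proof -
    have "w x \<noteq> 0" for x using pos[of x] by simp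
    then obtain x where x: "\<And>y. u y / w y \<le> u x / w x"
      using circle_Ck_0_attains_max[OF circle_Ck_0_divide[OF u(1) w(1)]] by metis
    define t where "t = u x / w x"
    have "0 < u x\<^sub>0 / w x\<^sub>0" using nz pos by simp
    then have t: "t > 0" using x[of x\<^sub>0] by (simp add: t_def)
    have ux: "u x = t * w x" using pos[of x] by (simp add: t_def)
    have "u y \<le> t * w y" for y
      using x[of y] pos[of y] by (simp add: t_def pos_divide_le_eq)
    then have "\<mu> * u x \<le> t * (\<alpha> x * w'' x + b x * w' x + c x * w x)"
      using elliptic_touching[OF u(2,3) w(2,3), of 1 x t "\<alpha> x" "b x" "c x"] eig[of x] ux \<alpha>[of x]
      by simp
    also have "\<dots> \<le> t * (\<kappa> * w x)"
      using super[of x] t by (intro mult_left_mono) auto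
    also have "\<dots> = \<kappa> * u x" by (simp add: ux)
    finally have "\<mu> * u x \<le> \<kappa> * u x" .
    moreover have "u x > 0" using ux t pos[of x] by simp
    ultimately show ?thesis by simp
  qed
  show ?thesis
  proof (cases "u x\<^sub>0 > 0")
    case True
    with main u eig show ?thesis by blast
  next
    case False
    show ?thesis
    proof (rule main)
      show "((\<lambda>x. - u x) has_real_derivative - u' x) (at x)" "((\<lambda>x. - u' x) has_real_derivative - u'' x) (at x)" for x
        using u(2,3)[of x] by (auto intro: DERIV_minus)
      show "\<alpha> x * - u'' x + b x * - u' x + c x * - u x = \<mu> * - u x" for x
        using eig[of x] by simp
    qed (use False nz u(1) in \<open>auto intro: circle_Ck_0_uminus\<close>)
  qed
qed

text \<open>The signs at the ends put a positive maximum of \<phi> / v inside the interval, so the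
  differential inequality is called for only where \<phi> > 0. The argument stays on
  \<open>{l..r}\<close>, which lets a bump on the line be compared directly with the lift of a
  periodic v.\<close>

lemma subsolution_le_eigenvalue:
  fixes \<phi> v :: "real \<Rightarrow> real"
  assumes phi: "\<And>x. (\<phi> has_real_derivative \<phi>' x) (at x)" "\<And>x. (\<phi>' has_real_derivative \<phi>'' x) (at x)"
    and v: "\<And>x. (v has_real_derivative v' x) (at x)" "\<And>x. (v' has_real_derivative v'' x) (at x)"
    and \<alpha>: "\<And>x. \<alpha> x \<ge> 0" and pos: "\<And>x. v x > 0"
    and eig: "\<And>x. \<alpha> x * v'' x + b x * v' x + c x * v x = \<mu> * v x"
    and ends: "\<phi> l \<le> 0" "\<phi> r \<le> 0" and mid: "l < m" "m < r" "\<phi> m > 0"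
    and sub: "\<And>x. l < x \<Longrightarrow> x < r \<Longrightarrow> \<phi> x > 0 \<Longrightarrow>
       \<kappa> * \<phi> x \<le> \<alpha> x * \<phi>'' x + b x * \<phi>' x + c x * \<phi> x"
  shows "\<kappa> \<le> \<mu>"
proof -
  have "v x \<noteq> 0" for x using pos[of x] by simp
  then have "continuous_on {l..r} (\<lambda>x. \<phi> x / v x)"
    using phi(1) v(1) by (auto intro!: continuous_at_imp_continuous_on continuous_intros intro: DERIV_isCont)
  then obtain x where x: "x \<in> {l..r}" "\<And>y. y \<in> {l..r} \<Longrightarrow> \<phi> y / v y \<le> \<phi> x / v x"
    using continuous_attains_sup[of "{l..r}" "\<lambda>x. \<phi> x / v x"] mid by auto
  define t where "t = \<phi> x / v x"
  have "0 < \<phi> m / v m" using mid pos by simp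
  then have t: "t > 0" using x(2)[of m] mid by (simp add: t_def)
  have eq: "\<phi> x = t * v x" using pos[of x] by (simp add: t_def)
  then have px: "\<phi> x > 0" using t pos[of x] by simp
  with ends have "x \<noteq> l" "x \<noteq> r" by auto
  with x(1) have lr: "l < x" "x < r" by auto
  have le: "\<phi> y \<le> t * v y" if "\<bar>y - x\<bar> < min (x - l) (r - x)" for y
  proof -
    have "y \<in> {l..r}" using that by (auto simp: abs_less_iff)
    then show ?thesis
      using x(2)[of y] pos[of y] by (simp add: t_def pos_divide_le_eq)
  qed
  have "\<kappa> * \<phi> x \<le> \<alpha> x * \<phi>'' x + b x * \<phi>' x + c x * \<phi> x"
    by (rule sub[OF lr px])
  also have "\<dots> \<le> t * (\<alpha> x * v'' x + b x * v' x + c x * v x)"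
    using lr by (intro elliptic_touching[OF phi v, of "min (x - l) (r - x)"] eq le \<alpha>) auto
  also have "\<dots> = \<mu> * \<phi> x" by (simp add: eig eq)
  finally show ?thesis using px by simp
qed

text \<open>
  Near a zero of \<open>b\<close> the operator resembles \<open>\<epsilon> a(x\<^sub>0) u'' + \<beta> y u' + c(x\<^sub>0) u\<close>. For \<open>\<beta> > 0\<close> this has the
  Gaussian \<open>exp (- \<beta> y\<^sup>2 / (2 \<epsilon> a(x\<^sub>0)))\<close> as eigenfunction with eigenvalue \<open>c(x\<^sub>0) - \<beta>\<close>; a slightly narrower
  Gaussian, cut off at height \<open>exp (- Q)\<close>, is a strict subsolution of the perturbed operator.
\<close>

lemma eigenvalue_lower_bound_at_zero:
  fixes a b c :: "real \<Rightarrow> real"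
  assumes a: "isCont a x\<^sub>0" "\<And>x. a x > 0" and c: "isCont c x\<^sub>0"
    and b: "b x\<^sub>0 = 0" "(b has_real_derivative \<beta>) (at x\<^sub>0)" and \<delta>: "\<delta> > 0"
  shows "\<forall>\<^sub>F \<epsilon> in at_right 0. \<forall>\<mu> v. real_eigenfunction (\<lambda>x. \<epsilon> * a x) b c \<mu> v \<longrightarrow> (\<forall>x. v x > 0) \<longrightarrow>
    - max 0 \<beta> + c x\<^sub>0 - \<delta> \<le> \<mu>"
proof -
  define B where "B = max 0 \<beta>"
  have B: "B \<ge> 0" "\<beta> \<le> B" by (auto simp: B_def)
  \<comment> \<open>The surplus \<delta> / 2 narrows the Gaussian and produces the gain \<delta> q
    below; it also keeps \<gamma> positive when \<beta> \<le> 0.\<close>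
  define \<gamma> where "\<gamma> = (B + \<delta> / 2) / a x\<^sub>0"
  have \<gamma>: "\<gamma> > 0" "\<gamma> * a x\<^sub>0 = B + \<delta> / 2"
    using B \<delta> a(2)[of x\<^sub>0] by (auto simp: \<gamma>_def intro!: divide_pos_pos add_nonneg_pos)
  \<comment> \<open>Chosen so that \<delta> (1 + Q) / 4 >= B + \<delta>, which pays for the cutoff
    in \<open>key\<close>.\<close>
  define Q where "Q = 4 * (B + \<delta>) / \<delta>"
  have Q: "Q > 0" "\<delta> * Q = 4 * (B + \<delta>)"
    using B \<delta> by (auto simp: Q_def intro!: divide_pos_pos add_nonneg_pos)
  \<comment> \<open>Bounds the factor that amplifies an error \<tau> in a and in the slope of b
    while q <= Q. The final 1 gives S >= 1, which limits the error in c to \<delta> / 8.\<close>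
  define S where "S = 2 * \<gamma> * Q + \<gamma> + 2 * Q + 1"
  have S: "S \<ge> 1" using \<gamma> Q by (simp add: S_def)
  define \<tau> where "\<tau> = \<delta> / 8 / S"
  have \<tau>: "\<tau> > 0" "\<tau> * S = \<delta> / 8" using \<delta> S by (auto simp: \<tau>_def)
  have "\<tau> * 1 \<le> \<tau> * S" using S \<tau>(1) by (intro mult_left_mono) auto
  then have \<tau>8: "\<tau> \<le> \<delta> / 8" using \<tau>(2) by linarith
  obtain d1 where d1: "d1 > 0" "\<And>x. \<bar>x - x\<^sub>0\<bar> < d1 \<Longrightarrow> \<bar>a x - a x\<^sub>0\<bar> < \<tau>"
    using a(1) \<tau>(1) unfolding continuous_at_eps_delta dist_real_def by metis
  obtain d2 where d2: "d2 > 0" "\<And>x. \<bar>x - x\<^sub>0\<bar> < d2 \<Longrightarrow> \<bar>c x - c x\<^sub>0\<bar> < \<tau>"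
    using c \<tau>(1) unfolding continuous_at_eps_delta dist_real_def by metis
  have "((\<lambda>h. b (x\<^sub>0 + h) / h) \<longlongrightarrow> \<beta>) (at 0)"
    using b by (simp add: DERIV_def)
  then obtain d3 where d3: "d3 > 0" "\<And>h. h \<noteq> 0 \<Longrightarrow> \<bar>h\<bar> < d3 \<Longrightarrow> \<bar>b (x\<^sub>0 + h) / h - \<beta>\<bar> < \<tau>"
    using \<tau>(1) unfolding LIM_eq by (metis diff_zero real_norm_def)
  have yb: "(x - x\<^sub>0) * b x \<le> (\<beta> + \<tau>) * (x - x\<^sub>0)\<^sup>2" if "\<bar>x - x\<^sub>0\<bar> < d3" for x
  proof (cases "x = x\<^sub>0")
    case False
    then have "b x / (x - x\<^sub>0) \<le> \<beta> + \<tau>"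
      using d3(2)[of "x - x\<^sub>0"] that by (simp add: abs_less_iff)
    then have "b x / (x - x\<^sub>0) * (x - x\<^sub>0)\<^sup>2 \<le> (\<beta> + \<tau>) * (x - x\<^sub>0)\<^sup>2"
      by (intro mult_right_mono) auto
    with False show ?thesis by (simp add: power2_eq_square mult.commute)
  qed simp
  define d where "d = min d1 (min d2 d3)"
  have d: "d > 0" using d1(1) d2(1) d3(1) by (simp add: d_def)
  show ?thesis
    unfolding eventually_at_right_field
  \<comment> \<open>This threshold amounts to r < d: the bump is positive only where a, b and c are
    controlled.\<close>
  proof (intro exI[of _ "\<gamma> * d\<^sup>2 / (2 * Q)"] conjI allI impI)
    show "\<gamma> * d\<^sup>2 / (2 * Q) > 0" using \<gamma> d Q by simp
    fix \<epsilon> \<mu> :: real and v :: "real \<Rightarrow> real"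
    assume \<epsilon>: "0 < \<epsilon>" "\<epsilon> < \<gamma> * d\<^sup>2 / (2 * Q)" and pos': "\<forall>x. v x > 0"
      and "real_eigenfunction (\<lambda>x. \<epsilon> * a x) b c \<mu> v"
    then obtain v' v'' where v: "\<And>x. (v has_real_derivative v' x) (at x)" "\<And>x. (v' has_real_derivative v'' x) (at x)"
      and eig: "\<And>x. \<epsilon> * a x * v'' x + b x * v' x + c x * v x = \<mu> * v x"
      by (auto simp: real_eigenfunction_def)
    have pos: "v x > 0" for x using pos' by simp
    define q where "q x = \<gamma> * (x - x\<^sub>0)\<^sup>2 / (2 * \<epsilon>)" for x
    define G where "G x = exp (- q x)" for x
    define m where "m = exp (- Q)"
    define r where "r = sqrt (2 * \<epsilon> * Q / \<gamma>)"
    have r0: "r > 0" using \<epsilon> Q \<gamma> by (simp add: r_def)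
    have r2: "r\<^sup>2 = 2 * \<epsilon> * Q / \<gamma>" using \<epsilon> Q \<gamma> by (simp add: r_def)
    have "2 * \<epsilon> * Q / \<gamma> < d\<^sup>2"
      using \<epsilon>(2) Q \<gamma> by (simp add: field_simps)
    then have rd: "r < d" using d r2 by (metis less_imp_le power2_less_imp_less)
    have q_r: "\<gamma> * r\<^sup>2 / (2 * \<epsilon>) = Q" using \<epsilon> \<gamma> by (simp add: r2)
    have dG: "(G has_real_derivative - (\<gamma> * (x - x\<^sub>0) / \<epsilon>) * G x) (at x)" for x
      unfolding G_def q_def using \<epsilon> by (auto intro!: derivative_eq_intros simp: field_simps)
    have dG': "((\<lambda>x. - (\<gamma> * (x - x\<^sub>0) / \<epsilon>) * G x) has_real_derivative
        (\<gamma>\<^sup>2 * (x - x\<^sub>0)\<^sup>2 / \<epsilon>\<^sup>2 - \<gamma> / \<epsilon>) * G x) (at x)" for x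
      using dG[of x] \<epsilon> by (auto intro!: derivative_eq_intros simp: field_simps power2_eq_square)
    show "- max 0 \<beta> + c x\<^sub>0 - \<delta> \<le> \<mu>"
    proof (rule subsolution_le_eigenvalue[OF _ dG' v _ pos eig])
      show "((\<lambda>x. G x - m) has_real_derivative - (\<gamma> * (x - x\<^sub>0) / \<epsilon>) * G x) (at x)" for x
        using dG[of x] by (auto intro!: derivative_eq_intros)
      show "0 \<le> \<epsilon> * a x" for x using \<epsilon> a(2)[of x] by simp
      show "G (x\<^sub>0 - r) - m \<le> 0" "G (x\<^sub>0 + r) - m \<le> 0"
        using q_r by (auto simp: G_def q_def m_def)
      show "x\<^sub>0 - r < x\<^sub>0" "x\<^sub>0 < x\<^sub>0 + r" using r0 by auto
      show "0 < G x\<^sub>0 - m" using Q by (simp add: G_def q_def m_def)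
      fix x assume x: "x\<^sub>0 - r < x" "x < x\<^sub>0 + r" and phi: "0 < G x - m"
      have xr: "\<bar>x - x\<^sub>0\<bar> < r" using x by (simp add: abs_less_iff)
      have q0: "q x \<ge> 0" using \<gamma> \<epsilon> by (simp add: q_def)
      have G0: "G x > 0" "m > 0" by (auto simp: G_def m_def)
      have qQ: "q x < Q" using phi by (simp add: G_def m_def)
      have ax: "a x\<^sub>0 - \<tau> \<le> a x" "a x \<le> a x\<^sub>0 + \<tau>"
        using d1(2)[of x] xr rd by (auto simp: d_def abs_less_iff)
      have cx: "c x\<^sub>0 - \<tau> \<le> c x"
        using d2(2)[of x] xr rd by (auto simp: d_def abs_less_iff)
      have bx: "(x - x\<^sub>0) * b x \<le> (\<beta> + \<tau>) * (x - x\<^sub>0)\<^sup>2"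
        using yb xr rd by (simp add: d_def)
      have second: "\<epsilon> * a x * (\<gamma>\<^sup>2 * (x - x\<^sub>0)\<^sup>2 / \<epsilon>\<^sup>2 - \<gamma> / \<epsilon>) = a x * (2 * \<gamma> * q x) - a x * \<gamma>"
        using \<epsilon> by (simp add: q_def field_simps power2_eq_square)
      have "a x * (2 * \<gamma> * q x) \<ge> (a x\<^sub>0 - \<tau>) * (2 * \<gamma> * q x)"
        using ax \<gamma> q0 by (intro mult_right_mono) auto
      moreover have "a x * \<gamma> \<le> (a x\<^sub>0 + \<tau>) * \<gamma>"
        using ax \<gamma> by (intro mult_right_mono) auto
      moreover have first: "b x * - (\<gamma> * (x - x\<^sub>0) / \<epsilon>) \<ge> - (2 * q x * (\<beta> + \<tau>))"
      proof -
        have "\<gamma> / \<epsilon> * ((x - x\<^sub>0) * b x) \<le> \<gamma> / \<epsilon> * ((\<beta> + \<tau>) * (x - x\<^sub>0)\<^sup>2)"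
          using bx \<gamma> \<epsilon> by (intro mult_left_mono) auto
        then show ?thesis using \<epsilon> by (simp add: q_def field_simps)
      qed
      ultimately have "a x * (2 * \<gamma> * q x) - a x * \<gamma> + b x * - (\<gamma> * (x - x\<^sub>0) / \<epsilon>)
          \<ge> (a x\<^sub>0 - \<tau>) * (2 * \<gamma> * q x) - (a x\<^sub>0 + \<tau>) * \<gamma> - 2 * q x * (\<beta> + \<tau>)"
        by linarith
      also have "(a x\<^sub>0 - \<tau>) * (2 * \<gamma> * q x) - (a x\<^sub>0 + \<tau>) * \<gamma> - 2 * q x * (\<beta> + \<tau>)
          = 2 * q x * (\<gamma> * a x\<^sub>0 - \<beta>) - \<gamma> * a x\<^sub>0 - \<tau> * (2 * \<gamma> * q x + \<gamma> + 2 * q x)"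
        by (simp add: algebra_simps)
      finally have "a x * (2 * \<gamma> * q x) - a x * \<gamma> + b x * - (\<gamma> * (x - x\<^sub>0) / \<epsilon>)
          \<ge> 2 * q x * (\<gamma> * a x\<^sub>0 - \<beta>) - \<gamma> * a x\<^sub>0 - \<tau> * (2 * \<gamma> * q x + \<gamma> + 2 * q x)" .
      moreover have "2 * q x * (\<gamma> * a x\<^sub>0 - \<beta>) \<ge> 2 * q x * (\<delta> / 2)"
        using \<gamma> B q0 by (intro mult_left_mono) auto
      moreover have "\<tau> * (2 * \<gamma> * q x + \<gamma> + 2 * q x) \<le> \<tau> * S"
      proof (intro mult_left_mono)
        have "\<gamma> * q x \<le> \<gamma> * Q" using qQ \<gamma> by (intro mult_left_mono) auto
        then show "2 * \<gamma> * q x + \<gamma> + 2 * q x \<le> S" using qQ by (simp add: S_def)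
      qed (use \<tau> in simp)
      \<comment> \<open>The loss 5 / 8 \<delta> is \<delta> / 2 from \<gamma> times
        \<open>a x\<^sub>0\<close> and \<delta> / 8 from \<tau> S.\<close>
      ultimately have coeff: "\<delta> * q x - B - 5 / 8 * \<delta>
          \<le> a x * (2 * \<gamma> * q x) - a x * \<gamma> + b x * - (\<gamma> * (x - x\<^sub>0) / \<epsilon>)"
        using \<gamma>(2) \<tau>(2) by (simp add: mult.commute)
      \<comment> \<open>Subtracting m costs at most (B + \<delta>) m. Near the centre G / m = exp (Q
        - q) is large, near the edge q is. By exp t >= 1 + t their product is at least a concave
        quadratic in q, which on [0, Q] is smallest at q = 0.\<close>
      have key: "(B + \<delta>) * m \<le> \<delta> * (q x + 1 / 4) * G x"
      proof -
        have "q x * (3 / 4 + Q - q x) \<ge> 0" using q0 qQ by simp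
        also have "q x * (3 / 4 + Q - q x) = (q x + 1 / 4) * (1 + (Q - q x)) - (1 + Q) / 4"
          by (simp add: field_simps)
        finally have "(1 + Q) / 4 \<le> (q x + 1 / 4) * (1 + (Q - q x))"
          by simp
        also have "\<dots> \<le> (q x + 1 / 4) * exp (Q - q x)"
          using q0 by (intro mult_left_mono exp_ge_add_one_self) auto
        finally have "\<delta> * ((1 + Q) / 4) \<le> \<delta> * ((q x + 1 / 4) * exp (Q - q x))"
          using \<delta> by (intro mult_left_mono) auto
        moreover have "\<delta> * ((1 + Q) / 4) \<ge> B + \<delta>"
          using Q \<delta> by (simp add: distrib_left)
        ultimately have "(B + \<delta>) * m \<le> \<delta> * ((q x + 1 / 4) * exp (Q - q x)) * m"
          using G0 by (intro mult_right_mono) auto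
        also have "exp (Q - q x) * m = G x"
          by (simp add: m_def G_def flip: exp_add)
        then have "\<delta> * ((q x + 1 / 4) * exp (Q - q x)) * m = \<delta> * (q x + 1 / 4) * G x"
          by (metis mult.assoc)
        finally show ?thesis .
      qed
      have "(\<delta> * q x - B - 5 / 8 * \<delta>) * G x
          \<le> (a x * (2 * \<gamma> * q x) - a x * \<gamma> + b x * - (\<gamma> * (x - x\<^sub>0) / \<epsilon>)) * G x"
        using coeff G0 by (intro mult_right_mono) auto
      moreover have "(c x\<^sub>0 - \<delta> / 8) * (G x - m) \<le> c x * (G x - m)"
        using cx \<tau>8 phi by (intro mult_right_mono) auto
      moreover have "(- B + c x\<^sub>0 - \<delta>) * (G x - m) \<le>
          (\<delta> * q x - B - 5 / 8 * \<delta>) * G x + (c x\<^sub>0 - \<delta> / 8) * (G x - m)"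
        using key mult_pos_pos[OF \<delta> G0(2)] by (simp add: field_simps)
      ultimately have "(- B + c x\<^sub>0 - \<delta>) * (G x - m) \<le>
          (a x * (2 * \<gamma> * q x) - a x * \<gamma> + b x * - (\<gamma> * (x - x\<^sub>0) / \<epsilon>)) * G x + c x * (G x - m)"
        by linarith
      also have "\<dots> = \<epsilon> * a x * ((\<gamma>\<^sup>2 * (x - x\<^sub>0)\<^sup>2 / \<epsilon>\<^sup>2 - \<gamma> / \<epsilon>) * G x) +
          b x * (- (\<gamma> * (x - x\<^sub>0) / \<epsilon>) * G x) + c x * (G x - m)"
        unfolding second[symmetric] by (simp only: distrib_right mult.assoc)
      finally show "(- max 0 \<beta> + c x\<^sub>0 - \<delta>) * (G x - m) \<le>
          \<epsilon> * a x * ((\<gamma>\<^sup>2 * (x - x\<^sub>0)\<^sup>2 / \<epsilon>\<^sup>2 - \<gamma> / \<epsilon>) * G x) +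
          b x * (- (\<gamma> * (x - x\<^sub>0) / \<epsilon>) * G x) + c x * (G x - m)"
        by (simp add: B_def)
    qed
  qed
qed

text \<open>On the compact part of a period where N >= V the penalty has a positive lower bound p,
  so P / \<epsilon> exceeds M + |V| there once \<epsilon> < p / (M + |V|); elsewhere N < V
  already.\<close>

lemma singular_penalty_bound:
  fixes N P :: "real \<Rightarrow> real"
  assumes N: "circle_Ck 0 N" and P: "circle_Ck 0 P" "\<And>x. P x \<ge> 0"
    and zero: "\<And>x. P x = 0 \<Longrightarrow> N x < V"
  obtains \<epsilon>\<^sub>0 where "\<epsilon>\<^sub>0 > 0" "\<And>\<epsilon> x. 0 < \<epsilon> \<Longrightarrow> \<epsilon> < \<epsilon>\<^sub>0 \<Longrightarrow> N x - P x / \<epsilon> \<le> V"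
proof -
  obtain M where M: "M > 0" "\<And>x. \<bar>N x\<bar> \<le> M" using circle_Ck_0_bounded[OF N] by blast
  define K where "K = {x \<in> {0..1}. V \<le> N x}"
  have "closed ({x. V \<le> N x})"
    using N by (auto simp: circle_Ck_0_iff intro!: closed_Collect_le continuous_intros)
  then have "compact ({0..1} \<inter> {x. V \<le> N x})"
    by (rule compact_Int_closed[OF compact_Icc])
  then have "compact K" by (simp add: K_def Int_def)
  obtain p where p: "p > 0" "\<And>x. x \<in> K \<Longrightarrow> p \<le> P x"
  proof (cases "K = {}")
    case True
    then show ?thesis using that[of 1] by simp
  next
    case False
    have "continuous_on K P"
      using P(1) by (meson circle_Ck_0_iff continuous_on_subset subset_UNIV)
    then obtain x where x: "x \<in> K" "\<And>y. y \<in> K \<Longrightarrow> P x \<le> P y"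
      using continuous_attains_inf[OF \<open>compact K\<close> False] by blast
    have "P x \<noteq> 0" using zero[of x] x(1) by (auto simp: K_def)
    with P(2)[of x] have "P x > 0" by simp
    then show ?thesis using that x(2) by blast
  qed
  show thesis
  proof (rule that)
    show "p / (M + \<bar>V\<bar>) > 0" using p(1) M(1) by simp
    fix \<epsilon> x :: real assume \<epsilon>: "0 < \<epsilon>" "\<epsilon> < p / (M + \<bar>V\<bar>)"
    have MV: "M + \<bar>V\<bar> > 0" using M(1) by simp
    have "N y - P y / \<epsilon> \<le> V" if "y \<in> {0..1}" for y
    proof (cases "y \<in> K")
      case True
      have "(M + \<bar>V\<bar>) * \<epsilon> \<le> P y"
        using \<epsilon>(2) MV p(2)[OF True] by (simp add: field_simps)
      then have "M + \<bar>V\<bar> \<le> P y / \<epsilon>" using \<epsilon>(1) by (simp add: field_simps)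
      then show ?thesis using M(2)[of y] by linarith
    next
      case False
      then have "N y < V" using that by (auto simp: K_def)
      moreover have "P y / \<epsilon> \<ge> 0" using P(2)[of y] \<epsilon>(1) by simp
      ultimately show ?thesis by linarith
    qed
    from this[of "frac x"] show "N x - P x / \<epsilon> \<le> V"
      using circle_Ck_0_frac[OF N, of x] circle_Ck_0_frac[OF P(1), of x]
      by (simp add: frac_ge_0 less_imp_le[OF frac_lt_1])
  qed
qed

text \<open>Strictness of 0 < \<psi> < 1 makes the penalty vanish only at zeros of b, where c -
  \<psi> b' remains. The continuous derivatives of a, b and \<psi> make the unpenalised part
  continuous, as \<open>singular_penalty_bound\<close> requires.\<close>

lemma eigenvalue_upper_bound:
  fixes a b c \<psi> \<Theta> :: "real \<Rightarrow> real"
  assumes a: "circle_Ck 0 a" "\<And>x. (a has_real_derivative a' x) (at x)" "circle_Ck 0 a'" "\<And>x. a x > 0"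
    and b: "circle_Ck 0 b" "\<And>x. (b has_real_derivative b' x) (at x)" "circle_Ck 0 b'"
    and c: "circle_Ck 0 c"
    and \<psi>: "circle_Ck 0 \<psi>" "\<And>x. (\<psi> has_real_derivative \<psi>' x) (at x)" "circle_Ck 0 \<psi>'"
      "\<And>x. 0 < \<psi> x" "\<And>x. \<psi> x < 1"
    and \<Theta>: "circle_Ck 0 \<Theta>" "\<And>x. (\<Theta> has_real_derivative \<psi> x * b x / a x) (at x)"
    and V: "\<And>x. b x = 0 \<Longrightarrow> c x - \<psi> x * b' x < V"
  shows "\<forall>\<^sub>F \<epsilon> in at_right 0. \<forall>\<mu> u. real_eigenfunction (\<lambda>x. \<epsilon> * a x) b c \<mu> u \<longrightarrow> (\<exists>x. u x \<noteq> 0) \<longrightarrow> \<mu> \<le> V"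
proof -
  have anz: "a x \<noteq> 0" for x using a(4)[of x] by simp
  define g' where "g' x = (\<psi>' x * b x + \<psi> x * b' x - \<psi> x * b x * a' x / a x) / a x" for x
  have g': "((\<lambda>x. \<psi> x * b x / a x) has_real_derivative g' x) (at x)" for x
    using \<psi>(2)[of x] b(2)[of x] a(2)[of x] anz[of x]
    by (auto intro!: derivative_eq_intros simp: g'_def field_simps)
  \<comment> \<open>L w / w = N - P / \<epsilon>: \<open>N\<close> collects the terms of order 1 and
    \<open>P\<close> those of order 1 / \<epsilon>.\<close>
  define N where "N x = c x - a x * g' x" for x
  define P where "P x = \<psi> x * (1 - \<psi> x) * (b x * b x) / a x" for x
  have "circle_Ck 0 N" unfolding N_def g'_def by (intro circle_Ck_0_intros a b c \<psi> anz)
  moreover have "circle_Ck 0 P" unfolding P_def by (intro circle_Ck_0_intros a b c \<psi> anz)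
  moreover have "P x \<ge> 0" for x
    using \<psi>(4,5)[of x] a(4)[of x] by (simp add: P_def)
  moreover have "N x < V" if "P x = 0" for x
  proof -
    have "b x = 0" using that \<psi>(4,5)[of x] anz[of x] by (simp add: P_def)
    with V[OF this] anz[of x] show ?thesis by (simp add: N_def g'_def)
  qed
  ultimately obtain \<epsilon>\<^sub>0 where \<epsilon>0: "\<epsilon>\<^sub>0 > 0" "\<And>\<epsilon> x. 0 < \<epsilon> \<Longrightarrow> \<epsilon> < \<epsilon>\<^sub>0 \<Longrightarrow> N x - P x / \<epsilon> \<le> V"
    using singular_penalty_bound by blast
  show ?thesis
    unfolding eventually_at_right_field
  proof (intro exI[of _ \<epsilon>\<^sub>0] conjI allI impI \<epsilon>0(1))
    fix \<epsilon> \<mu> :: real and u :: "real \<Rightarrow> real"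
    assume \<epsilon>: "0 < \<epsilon>" "\<epsilon> < \<epsilon>\<^sub>0"
      and "real_eigenfunction (\<lambda>x. \<epsilon> * a x) b c \<mu> u" "\<exists>x. u x \<noteq> 0"
    then obtain u' u'' x\<^sub>0 where u: "circle_Ck 0 u" "u x\<^sub>0 \<noteq> 0" "\<And>x. (u has_real_derivative u' x) (at x)"
        "\<And>x. (u' has_real_derivative u'' x) (at x)"
        "\<And>x. \<epsilon> * a x * u'' x + b x * u' x + c x * u x = \<mu> * u x"
      by (auto simp: real_eigenfunction_def)
    define w where "w x = exp (- \<Theta> x / \<epsilon>)" for x
    have w1: "(w has_real_derivative - (\<psi> x * b x / a x) / \<epsilon> * w x) (at x)" for x
      unfolding w_def using \<Theta>(2)[of x] \<epsilon> by (auto intro!: derivative_eq_intros)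
    have w2: "((\<lambda>x. - (\<psi> x * b x / a x) / \<epsilon> * w x) has_real_derivative
        ((\<psi> x * b x / a x / \<epsilon>)\<^sup>2 - g' x / \<epsilon>) * w x) (at x)" for x
    proof -
      have "((\<lambda>x. - (\<psi> x * b x / a x) / \<epsilon> * w x) has_real_derivative
          - g' x / \<epsilon> * w x + - (\<psi> x * b x / a x) / \<epsilon> * (- (\<psi> x * b x / a x) / \<epsilon> * w x)) (at x)"
        using DERIV_mult[OF DERIV_cdivide[OF DERIV_minus[OF g'[of x]], of \<epsilon>] w1[of x]]
        by (simp add: add.commute mult.commute)
      moreover have "- g' x / \<epsilon> * w x + - (\<psi> x * b x / a x) / \<epsilon> * (- (\<psi> x * b x / a x) / \<epsilon> * w x)
          = ((\<psi> x * b x / a x / \<epsilon>)\<^sup>2 - g' x / \<epsilon>) * w x"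
        by (simp add: power2_eq_square left_diff_distrib)
      ultimately show ?thesis by simp
    qed
    have "w (x + 1) = w x" for x
      by (simp add: w_def circle_Ck_0_period[OF \<Theta>(1)])
    moreover have "continuous_on UNIV w"
      using DERIV_isCont[OF w1] by (simp add: continuous_on_eq_continuous_at)
    ultimately have wper: "circle_Ck 0 w"
      by (simp add: circle_Ck_0_iff)
    show "\<mu> \<le> V"
    proof (rule eigenvalue_le_supersolution[OF u(1,3,4) wper w1 w2 _ _ u(5) _ u(2)])
      show "0 \<le> \<epsilon> * a x" for x using \<epsilon> a(4)[of x] by simp
      show "0 < w x" for x by (simp add: w_def)
      show "\<epsilon> * a x * (((\<psi> x * b x / a x / \<epsilon>)\<^sup>2 - g' x / \<epsilon>) * w x) +
          b x * (- (\<psi> x * b x / a x) / \<epsilon> * w x) + c x * w x \<le> V * w x" for x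
      proof -
        have "\<epsilon> * a x * ((\<psi> x * b x / a x / \<epsilon>)\<^sup>2 - g' x / \<epsilon>) + b x * (- (\<psi> x * b x / a x) / \<epsilon>) + c x
            = N x - P x / \<epsilon>"
          using \<epsilon> anz[of x] by (simp add: N_def P_def field_simps power2_eq_square)
        also have "\<dots> \<le> V" by (rule \<epsilon>0(2)[OF \<epsilon>])
        finally have "(\<epsilon> * a x * ((\<psi> x * b x / a x / \<epsilon>)\<^sup>2 - g' x / \<epsilon>) +
            b x * (- (\<psi> x * b x / a x) / \<epsilon>) + c x) * w x \<le> V * w x"
          by (intro mult_right_mono) (auto simp: w_def)
        then show ?thesis by (simp only: distrib_right mult.assoc)
      qed
    qed
  qed
qed

section \<open>Real and complex eigenfunctions\<close>

lemma circle_Ck_Suc_imp_0: "circle_Ck (Suc k) f \<Longrightarrow> circle_Ck 0 f"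
  by (simp add: circle_Ck_def differentiable_imp_continuous_within continuous_on_eq_continuous_at)

lemma circle_Ck_Suc_has_vector_derivative:
  "circle_Ck (Suc k) f \<Longrightarrow> (f has_vector_derivative vector_derivative f (at x)) (at x)"
  by (simp add: circle_Ck_def vector_derivative_works)

lemma circle_Ck_Suc_derivative:
  assumes "circle_Ck (Suc k) f"
  shows "circle_Ck k (\<lambda>x. vector_derivative f (at x))"
proof -
  note der = circle_Ck_Suc_has_vector_derivative[OF assms]
  have "vector_derivative f (at (x + 1)) = vector_derivative f (at x)" for x
  proof -
    have "((f \<circ> (\<lambda>x. x + 1)) has_vector_derivative 1 *\<^sub>R vector_derivative f (at (x + 1))) (at x)"
      by (rule vector_diff_chain_at) (use der[of "x + 1"] in \<open>auto intro!: derivative_eq_intros\<close>)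
    moreover have "f \<circ> (\<lambda>x. x + 1) = f"
      using circle_Ck_0_period[OF circle_Ck_Suc_imp_0[OF assms]] by auto
    ultimately show ?thesis
      using vector_derivative_unique_at[OF der[of x]] by auto
  qed
  then show ?thesis
    using assms by (simp add: circle_Ck_def periodic_fun_simple'_def)
qed

lemma circle_Ck_Suc_real_derivative:
  fixes b :: "real \<Rightarrow> real"
  assumes "circle_Ck (Suc k) b"
  shows "(b has_real_derivative deriv b x) (at x)"
    and "circle_Ck k (deriv b)"
proof -
  note der = circle_Ck_Suc_has_vector_derivative[OF assms]
  have *: "vector_derivative b (at x) = deriv b x" for x
    using der[of x] by (metis DERIV_imp_deriv has_real_derivative_iff_has_vector_derivative)
  show "(b has_real_derivative deriv b x) (at x)"
    using der[of x] by (simp add: * has_real_derivative_iff_has_vector_derivative)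
  show "circle_Ck k (deriv b)"
    using circle_Ck_Suc_derivative[OF assms] by (simp add: *)
qed

text \<open>For real coefficients and a real eigenvalue, the real and imaginary parts solve the same
  equation, and one of them is nonzero where the complex eigenfunction is.\<close>

lemma circle_eigenvalue_real_eigenfunction:
  assumes "circle_eigenvalue (circle_op a b c \<epsilon>) (complex_of_real \<mu>)"
  obtains u where "real_eigenfunction (\<lambda>x. \<epsilon> * a x) b c \<mu> u" "\<exists>x. u x \<noteq> 0"
proof -
  obtain U x\<^sub>0 where U: "circle_Ck (Suc (Suc 0)) U" "U x\<^sub>0 \<noteq> 0"
    "\<And>x. circle_op a b c \<epsilon> U x = complex_of_real \<mu> * U x"
    using assms by (auto simp: circle_eigenvalue_def numeral_2_eq_2)
  define U' where "U' x = vector_derivative U (at x)" for x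
  define U'' where "U'' x = vector_derivative U' (at x)" for x
  have U': "(U has_vector_derivative U' x) (at x)" "(U' has_vector_derivative U'' x) (at x)" for x
    using circle_Ck_Suc_has_vector_derivative[OF U(1), of x]
      circle_Ck_Suc_has_vector_derivative[OF circle_Ck_Suc_derivative[OF U(1)], of x]
    by (simp_all add: U'_def[abs_def] U''_def)
  have eq: "complex_of_real (\<epsilon> * a x) * U'' x + complex_of_real (b x) * U' x + complex_of_real (c x) * U x
      = complex_of_real \<mu> * U x" for x
    using U(3)[of x] by (simp add: circle_op_def U''_def U'_def[abs_def])
  note result = that
  have part: thesis
    if T: "bounded_linear T" "\<And>r z. T (complex_of_real r * z) = r * T z" and nz: "T (U x\<^sub>0) \<noteq> 0"
    for T :: "complex \<Rightarrow> real"
  proof (rule result)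
    have "circle_Ck 0 (\<lambda>x. T (U x))"
      using circle_Ck_Suc_imp_0[OF U(1)] bounded_linear.continuous_on[OF T(1)]
      by (auto simp: circle_Ck_0_iff)
    moreover have "((\<lambda>x. T (U x)) has_real_derivative T (U' x)) (at x)"
      "((\<lambda>x. T (U' x)) has_real_derivative T (U'' x)) (at x)" for x
      using bounded_linear.has_vector_derivative[OF T(1)] U'[of x]
      by (auto simp: has_real_derivative_iff_has_vector_derivative)
    moreover have "\<epsilon> * a x * T (U'' x) + b x * T (U' x) + c x * T (U x) = \<mu> * T (U x)" for x
      using arg_cong[OF eq[of x], of T]
      by (simp add: T(2) linear_add[OF bounded_linear.linear[OF T(1)]] del: of_real_mult)
    ultimately show "real_eigenfunction (\<lambda>x. \<epsilon> * a x) b c \<mu> (\<lambda>x. T (U x))"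
      unfolding real_eigenfunction_def
      by (intro conjI exI[of _ "\<lambda>x. T (U' x)"] exI[of _ "\<lambda>x. T (U'' x)"] allI) auto
    show "\<exists>x. T (U x) \<noteq> 0" using nz by blast
  qed
  show thesis
  proof (cases "Re (U x\<^sub>0) = 0")
    case True
    with U(2) have "Im (U x\<^sub>0) \<noteq> 0" by (simp add: complex_eq_iff)
    then show ?thesis by (intro part[of Im]) (auto intro: bounded_linear_Im)
  next
    case False
    then show ?thesis by (intro part[of Re]) (auto intro: bounded_linear_Re)
  qed
qed

lemma circle_eigenvalue_of_real_eigenfunction:
  fixes v :: "real \<Rightarrow> real"
  assumes "real_eigenfunction (\<lambda>x. \<epsilon> * a x) b c \<mu> v" "v x\<^sub>0 \<noteq> 0"
    and \<epsilon>a: "\<And>x. \<epsilon> * a x \<noteq> 0" "circle_Ck 0 a" and b: "circle_Ck 0 b" and c: "circle_Ck 0 c"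
  shows "circle_eigenvalue (circle_op a b c \<epsilon>) (complex_of_real \<mu>)"
proof -
  obtain v' v'' where v: "circle_Ck 0 v" "v x\<^sub>0 \<noteq> 0" "\<And>x. (v has_real_derivative v' x) (at x)"
    "\<And>x. (v' has_real_derivative v'' x) (at x)"
    and eig: "\<And>x. \<epsilon> * a x * v'' x + b x * v' x + c x * v x = \<mu> * v x"
    using assms by (auto simp: real_eigenfunction_def)
  have "continuous_on UNIV v'"
    using DERIV_isCont[OF v(4)] by (simp add: continuous_on_eq_continuous_at)
  \<comment> \<open>Continuity of \<open>v''\<close>, demanded by \<open>circle_Ck 2\<close>, comes
    from solving the equation for it.\<close>
  then have "continuous_on UNIV (\<lambda>x. (\<mu> * v x - b x * v' x - c x * v x) / (\<epsilon> * a x))"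
    using v(1) \<epsilon>a b c by (auto simp: circle_Ck_0_iff intro!: continuous_intros)
  moreover have "(\<mu> * v x - b x * v' x - c x * v x) / (\<epsilon> * a x) = v'' x" for x
    using eig[of x] \<epsilon>a(1)[of x] by (simp add: divide_eq_eq algebra_simps)
  ultimately have v'': "continuous_on UNIV v''" by simp
  define U where "U x = complex_of_real (v x)" for x
  have lift: "((\<lambda>x. complex_of_real (f x)) has_vector_derivative complex_of_real d) (at x)"
    if "(f has_real_derivative d) (at x)" for f d x
    using that bounded_linear.has_vector_derivative[OF bounded_linear_of_real]
    by (auto simp: has_real_derivative_iff_has_vector_derivative)
  have d1: "(U has_vector_derivative complex_of_real (v' x)) (at x)" for x
    unfolding U_def by (rule lift[OF v(3)])
  have d2: "((\<lambda>x. complex_of_real (v' x)) has_vector_derivative complex_of_real (v'' x)) (at x)" for x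
    by (rule lift[OF v(4)])
  note vd = vector_derivative_at[OF d1] vector_derivative_at[OF d2]
  have diff: "U differentiable at x" "(\<lambda>x. complex_of_real (v' x)) differentiable at x" for x
    using d1 d2 by (auto intro: differentiableI_vector)
  have "circle_Ck 2 U"
    using v(1) v'' diff by (auto simp: circle_Ck_def numeral_2_eq_2 vd U_def periodic_fun_simple'_def
        intro!: continuous_intros)
  moreover have "U x\<^sub>0 \<noteq> 0" using v(2) by (simp add: U_def)
  moreover have "circle_op a b c \<epsilon> U x = complex_of_real \<mu> * U x" for x
    using arg_cong[OF eig[of x], of complex_of_real] by (simp add: circle_op_def vd) (simp add: U_def)
  ultimately show ?thesis
    unfolding circle_eigenvalue_def by blast
qed

section \<open>The balanced drift cutoff\<close>

lemma circle_Ck_0_antiderivative_mean_zero: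
  fixes f :: "real \<Rightarrow> real"
  assumes "circle_Ck 0 f" "integral {0..1} f = 0"
  obtains F where "circle_Ck 0 F" "\<And>x. (F has_real_derivative f x) (at x)"
proof -
  obtain F where F: "\<And>x. (F has_real_derivative f x) (at x)" "\<And>x. F (x + 1) - F x = F 1 - F 0"
    using circle_Ck_0_antiderivative[OF assms(1)] by metis
  have "(f has_integral F 1 - F 0) {0..1}"
    using F(1) by (intro fundamental_theorem_of_calculus)
      (auto simp: has_real_derivative_iff_has_vector_derivative intro: has_vector_derivative_at_within)
  then have "F 1 - F 0 = 0"
    using assms(2) by (simp add: integral_unique)
  then have "F (x + 1) = F x" for x using F(2)[of x] by simp
  moreover have "continuous_on UNIV F"
    using DERIV_isCont[OF F(1)] by (simp add: continuous_on_eq_continuous_at)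
  ultimately have "circle_Ck 0 F" by (simp add: circle_Ck_0_iff)
  then show thesis using F(1) by (rule that)
qed

lemma circle_Ck_0_integrable:
  fixes f :: "real \<Rightarrow> real"
  shows "circle_Ck 0 f \<Longrightarrow> f integrable_on {0..1}"
  by (meson circle_Ck_0_iff continuous_on_subset integrable_continuous_real subset_UNIV)

text \<open>Squaring smooths the kink of the positive part, which keeps the damping factor below
  C^1.\<close>

lemma DERIV_max_0_square:
  "((\<lambda>t::real. (max 0 t)\<^sup>2) has_real_derivative 2 * max 0 t) (at t)"
proof (cases t "0 :: real" rule: linorder_cases)
  case less
  have "((\<lambda>t. 0) has_real_derivative 2 * max 0 t) (at t)"
    using less by simp
  then show ?thesis
    by (rule has_field_derivative_transform_within_open[of _ _ _ "{..<0}"]) (use less in auto)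
next
  case equal
  have "((\<lambda>h. (max 0 h)\<^sup>2 / h) \<longlongrightarrow> 0) (at (0::real))"
  proof (rule Lim_null_comparison)
    show "\<forall>\<^sub>F h in at 0. norm ((max 0 h)\<^sup>2 / h) \<le> \<bar>h\<bar>"
      by (auto simp: max_def power2_eq_square)
    show "((\<lambda>h. \<bar>h\<bar>) \<longlongrightarrow> 0) (at (0::real))"
      by (intro tendsto_rabs_zero tendsto_ident_at)
  qed
  with equal show ?thesis by (simp add: DERIV_def)
next
  case greater
  have "((\<lambda>t. t\<^sup>2) has_real_derivative 2 * max 0 t) (at t)"
    using greater by (auto intro!: derivative_eq_intros)
  then show ?thesis
    by (rule has_field_derivative_transform_within_open[of _ _ _ "{0<..}"]) (use greater in auto)
qed

text \<open>Damping b only where it is positive, by j = 1 / (1 + \<sigma>^2 (max 0 b)^2), pushes the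
  mean of b \<omega> below zero; a convex combination of 1 and j then makes it vanish. Since j = 1
  where b <= 0, the zeros of b are untouched.\<close>

lemma balancing_cutoff_nonneg_mean:
  fixes b \<omega> :: "real \<Rightarrow> real"
  assumes b: "circle_Ck 0 b" "\<And>x. (b has_real_derivative b' x) (at x)" "circle_Ck 0 b'"
    and neg: "b x\<^sub>0 < 0" and \<omega>: "circle_Ck 0 \<omega>" "\<And>x. \<omega> x > 0"
    and I: "integral {0..1} (\<lambda>x. b x * \<omega> x) \<ge> 0"
  obtains k k' where "circle_Ck 0 k" "\<And>x. (k has_real_derivative k' x) (at x)" "circle_Ck 0 k'"
    "\<And>x. 0 < k x" "\<And>x. k x \<le> 1" "\<And>x. b x = 0 \<Longrightarrow> k x = 1"
    "integral {0..1} (\<lambda>x. k x * (b x * \<omega> x)) = 0"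
proof -
  have C0_clip: "circle_Ck 0 (\<lambda>x. max 0 (f x))" "circle_Ck 0 (\<lambda>x. min 0 (f x))"
    if "circle_Ck 0 f" for f :: "real \<Rightarrow> real"
    using that by (auto simp: circle_Ck_0_iff intro!: continuous_intros)
  have b\<omega>: "circle_Ck 0 (\<lambda>x. b x * \<omega> x)" by (intro circle_Ck_0_intros b \<omega>)
  define f where "f x = min 0 (b x * \<omega> x)" for x
  have f: "circle_Ck 0 f" unfolding f_def by (intro C0_clip b\<omega>)
  \<comment> \<open>The mass of the negative part of b \<omega>, which the damping leaves
    intact.\<close>
  define m where "m = - integral {0..1} f"
  have m: "m > 0"
  proof -
    have "f x\<^sub>0 < 0"
      using mult_neg_pos[OF neg \<omega>(2)[of x\<^sub>0]] by (simp add: f_def)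
    then have "f (frac x\<^sub>0) < 0"
      by (simp only: circle_Ck_0_frac[OF f])
    moreover have "frac x\<^sub>0 \<in> {0..1}" by (simp add: frac_ge_0 less_imp_le[OF frac_lt_1])
    moreover have "continuous_on {0..1} (\<lambda>x. - f x)"
      using f by (intro continuous_intros) (meson circle_Ck_0_iff continuous_on_subset subset_UNIV)
    ultimately have "integral {0..1} (\<lambda>x. - f x) \<noteq> 0"
      using integral_eq_0_iff[of 0 1 "\<lambda>x. - f x"] by (force simp: f_def)
    moreover have "integral {0..1} (\<lambda>x. - f x) \<ge> 0"
      using circle_Ck_0_integrable[OF circle_Ck_0_uminus[OF f]]
      by (intro integral_nonneg) (auto simp: f_def)
    ultimately show ?thesis
      by (simp add: m_def)
  qed
  obtain W where W: "W > 0" "\<And>x. \<bar>\<omega> x\<bar> \<le> W" using circle_Ck_0_bounded[OF \<omega>(1)] by blast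
  \<comment> \<open>By 1 + t^2 >= 2 t, j b <= 1 / (2 \<sigma>) where b > 0, so this choice leaves at
    most m / 2 of positive mass against the negative mass m.\<close>
  define \<sigma> where "\<sigma> = W / m"
  have \<sigma>: "\<sigma> > 0" "W / \<sigma> = m" using W m by (auto simp: \<sigma>_def)
  define q where "q x = (max 0 (b x))\<^sup>2" for x
  have q: "circle_Ck 0 q" unfolding q_def power2_eq_square by (intro circle_Ck_0_intros C0_clip b)
  define j where "j x = 1 / (1 + \<sigma>\<^sup>2 * q x)" for x
  have den: "1 + \<sigma>\<^sup>2 * q x > 0" for x
    by (simp add: q_def add_pos_nonneg)
  then have dnz: "1 + \<sigma>\<^sup>2 * q x \<noteq> 0" for x by (metis less_irrefl)
  have j: "circle_Ck 0 j"
    unfolding j_def by (intro circle_Ck_0_divide circle_Ck_0_add circle_Ck_0_mult circle_Ck_0_const q dnz)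
  have j01: "0 < j x" "j x \<le> 1" for x
    using den[of x] by (auto simp: j_def q_def)
  define j' where "j' x = - (\<sigma>\<^sup>2 * (2 * max 0 (b x) * b' x)) / ((1 + \<sigma>\<^sup>2 * q x) * (1 + \<sigma>\<^sup>2 * q x))" for x
  have "(q has_real_derivative 2 * max 0 (b x) * b' x) (at x)" for x
    unfolding q_def by (rule DERIV_chain2[OF DERIV_max_0_square b(2)])
  then have dj: "(j has_real_derivative j' x) (at x)" for x
    unfolding j_def j'_def using dnz[of x] by (auto intro!: derivative_eq_intros)
  have j': "circle_Ck 0 j'"
    unfolding j'_def
    by (intro circle_Ck_0_divide circle_Ck_0_uminus circle_Ck_0_add circle_Ck_0_mult circle_Ck_0_const q b C0_clip)
      (use dnz in simp)
  have jb: "j x * (b x * \<omega> x) \<le> f x + m / 2" for x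
  proof (cases "b x > 0")
    case True
    have "2 * (\<sigma> * b x) \<le> 1 + \<sigma>\<^sup>2 * q x"
      using True zero_le_power2[of "1 - \<sigma> * b x"] by (simp add: q_def power2_eq_square algebra_simps)
    then have "2 * (\<sigma> * b x) * j x \<le> 1"
      using den[of x] by (simp add: j_def)
    then have "j x * b x \<le> 1 / (2 * \<sigma>)"
      using \<sigma>(1) by (simp add: field_simps)
    then have "(j x * b x) * \<omega> x \<le> 1 / (2 * \<sigma>) * W"
      using W(2)[of x] \<omega>(2)[of x] \<sigma>(1) by (intro mult_mono) auto
    also have "\<dots> = m / 2" using \<sigma> by (simp add: field_simps)
    finally show ?thesis
      using True \<omega>(2)[of x] by (simp add: f_def mult.assoc)
  next
    case False
    then have "b x * \<omega> x \<le> 0"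
      using \<omega>(2)[of x] by (intro mult_nonpos_nonneg) auto
    with False have "j x = 1" "f x = b x * \<omega> x"
      by (auto simp: j_def q_def f_def)
    with m show ?thesis by simp
  qed
  define I\<^sub>0 where "I\<^sub>0 = integral {0..1} (\<lambda>x. b x * \<omega> x)"
  define I\<^sub>1 where "I\<^sub>1 = integral {0..1} (\<lambda>x. j x * (b x * \<omega> x))"
  have jb\<omega>: "circle_Ck 0 (\<lambda>x. j x * (b x * \<omega> x))" by (intro circle_Ck_0_mult j b\<omega>)
  have "I\<^sub>1 \<le> integral {0..1} (\<lambda>x. f x + m / 2)"
    unfolding I\<^sub>1_def
    by (intro integral_le circle_Ck_0_integrable jb\<omega> circle_Ck_0_add circle_Ck_0_const f jb)
  also have "\<dots> = - m + m / 2"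
    using circle_Ck_0_integrable[OF f] by (subst integral_add) (auto simp: m_def)
  finally have I1: "I\<^sub>1 < 0" using m by simp
  have I0: "I\<^sub>0 \<ge> 0" using I by (simp add: I\<^sub>0_def)
  \<comment> \<open>The root of the affine function s -> (1 - s) \<open>I\<^sub>0\<close> + s
    \<open>I\<^sub>1\<close>, whose end values have opposite signs or vanish at s = 0.\<close>
  define s where "s = I\<^sub>0 / (I\<^sub>0 - I\<^sub>1)"
  have s: "0 \<le> s" "s \<le> 1" "(1 - s) * I\<^sub>0 + s * I\<^sub>1 = 0"
    using I0 I1 by (auto simp: s_def field_simps)
  show thesis
  proof (rule that)
    show "circle_Ck 0 (\<lambda>x. (1 - s) + s * j x)" by (intro circle_Ck_0_add circle_Ck_0_mult circle_Ck_0_const j)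
    show "((\<lambda>x. (1 - s) + s * j x) has_real_derivative s * j' x) (at x)" for x
      using dj[of x] by (auto intro!: derivative_eq_intros)
    show "circle_Ck 0 (\<lambda>x. s * j' x)" by (intro circle_Ck_0_mult circle_Ck_0_const j')
    show "0 < (1 - s) + s * j x" for x
    proof (cases "s = 0")
      case False
      then have "s * j x > 0" using s(1) j01(1)[of x] by simp
      with s(2) show ?thesis by linarith
    qed simp
    show "(1 - s) + s * j x \<le> 1" for x
      using mult_left_mono[OF j01(2)[of x] s(1)] by simp
    show "(1 - s) + s * j x = 1" if "b x = 0" for x
      using that by (simp add: j_def q_def)
    have "(\<lambda>x. ((1 - s) + s * j x) * (b x * \<omega> x)) = (\<lambda>x. (1 - s) * (b x * \<omega> x) + s * (j x * (b x * \<omega> x)))"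
      by (auto simp: algebra_simps)
    moreover have "integral {0..1} (\<lambda>x. (1 - s) * (b x * \<omega> x) + s * (j x * (b x * \<omega> x))) = (1 - s) * I\<^sub>0 + s * I\<^sub>1"
      using circle_Ck_0_integrable[OF b\<omega>] circle_Ck_0_integrable[OF jb\<omega>]
      by (subst integral_add) (auto simp: I\<^sub>0_def I\<^sub>1_def intro: integrable_on_mult_right)
    ultimately show "integral {0..1} (\<lambda>x. ((1 - s) + s * j x) * (b x * \<omega> x)) = 0"
      using s(3) by simp
  qed
qed

text \<open>If the mean is negative, - b has positive mean and the same zeros; each case uses one of
  the two signs that b takes.\<close>

lemma balancing_cutoff:
  fixes b \<omega> :: "real \<Rightarrow> real"
  assumes b: "circle_Ck 0 b" "\<And>x. (b has_real_derivative b' x) (at x)" "circle_Ck 0 b'"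
    and sign: "b x\<^sub>0 < 0" "b x\<^sub>1 > 0" and \<omega>: "circle_Ck 0 \<omega>" "\<And>x. \<omega> x > 0"
  obtains k k' where "circle_Ck 0 k" "\<And>x. (k has_real_derivative k' x) (at x)" "circle_Ck 0 k'"
    "\<And>x. 0 < k x" "\<And>x. k x \<le> 1" "\<And>x. b x = 0 \<Longrightarrow> k x = 1"
    "integral {0..1} (\<lambda>x. k x * (b x * \<omega> x)) = 0"
proof (cases "integral {0..1} (\<lambda>x. b x * \<omega> x) \<ge> 0")
  case True
  show thesis
    by (rule balancing_cutoff_nonneg_mean[OF b sign(1) \<omega> True]) (rule that)
next
  case False
  have neg: "((\<lambda>x. - b x) has_real_derivative - b' x) (at x)" for x
    using b(2)[of x] by (rule DERIV_minus)
  have "- b x\<^sub>1 < 0" "0 \<le> integral {0..1} (\<lambda>x. - b x * \<omega> x)"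
    using sign False by auto
  then obtain k k' where k: "circle_Ck 0 k" "\<And>x. (k has_real_derivative k' x) (at x)" "circle_Ck 0 k'"
    "\<And>x. 0 < k x" "\<And>x. k x \<le> 1" "\<And>x. - b x = 0 \<Longrightarrow> k x = 1"
    "integral {0..1} (\<lambda>x. k x * (- b x * \<omega> x)) = 0"
    by (rule balancing_cutoff_nonneg_mean[OF circle_Ck_0_uminus[OF b(1)] neg circle_Ck_0_uminus[OF b(3)] _ \<omega>]) (rule that)
  show thesis
    by (rule that[OF k(1-5)]) (use k(6,7) in auto)
qed

text \<open>The quotient is as smooth as b, whereas b' is only continuous, so it can enter a cutoff
  that must be differentiated.\<close>

lemma difference_quotient_approx:
  fixes b :: "real \<Rightarrow> real"
  assumes b: "circle_Ck 0 b" "\<And>x. (b has_real_derivative b' x) (at x)" "circle_Ck 0 b'" and \<eta>: "\<eta> > 0"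
  obtains h where "h > 0" "\<And>x. \<bar>(b (x + h) - b x) / h - b' x\<bar> < \<eta>"
proof -
  \<comment> \<open>The interval reaches 2 because it has to contain x + h for x in [0, 1] and h <=
    1.\<close>
  have "uniformly_continuous_on {0..2} b'"
    by (intro compact_uniformly_continuous) (use b(3) in \<open>auto simp: circle_Ck_0_iff intro: continuous_on_subset\<close>)
  then obtain d where d: "d > 0" "\<And>x y. x \<in> {0..2} \<Longrightarrow> y \<in> {0..2} \<Longrightarrow> \<bar>y - x\<bar> < d \<Longrightarrow> \<bar>b' y - b' x\<bar> < \<eta>"
    using \<eta> unfolding uniformly_continuous_on_def dist_real_def by metis
  define h where "h = min 1 (d / 2)"
  have h: "h > 0" "h \<le> 1" "h < d" using d(1) by (auto simp: h_def min_def)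
  have "\<bar>(b (x + h) - b x) / h - b' x\<bar> < \<eta>" if "x \<in> {0..1}" for x
  proof -
    obtain z where z: "x < z" "z < x + h" "b (x + h) - b x = (x + h - x) * b' z"
      using MVT2[of x "x + h" b b'] b(2) h(1) by auto
    then have "(b (x + h) - b x) / h = b' z" using h(1) by simp
    moreover have "\<bar>b' z - b' x\<bar> < \<eta>"
      using that z h by (intro d(2)) auto
    ultimately show ?thesis by simp
  qed
  moreover have "b (frac x + h) = b (x + h)" for x
    using circle_Ck_0_minus_of_int[OF b(1), of "x + h" "\<lfloor>x\<rfloor>"] by (simp add: frac_def algebra_simps)
  ultimately have "\<bar>(b (x + h) - b x) / h - b' x\<bar> < \<eta>" for x
    using circle_Ck_0_frac[OF b(1), of x] circle_Ck_0_frac[OF b(3), of x]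
    by (metis atLeastAtMost_iff frac_ge_0 frac_lt_1 less_imp_le)
  with h(1) show thesis by (rule that)
qed

text \<open>For either sign of g this comes down to t <= exp t with t = \<rho> |g|. The lower bound
  is the direction that makes c - \<psi> b' small.\<close>

lemma logistic_approx_positive_part:
  fixes g \<rho> :: real
  assumes "\<rho> > 0"
  shows "max 0 g - 1 / \<rho> \<le> g / (1 + exp (- \<rho> * g))"
proof (cases "g \<ge> 0")
  case True
  have "\<rho> * g * exp (- \<rho> * g) \<le> 1"
  proof -
    have "\<rho> * g \<le> exp (\<rho> * g)" using exp_ge_add_one_self[of "\<rho> * g"] by linarith
    then have "\<rho> * g * exp (- (\<rho> * g)) \<le> exp (\<rho> * g) * exp (- (\<rho> * g))"
      by (intro mult_right_mono) auto
    then show ?thesis by (simp flip: exp_add)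
  qed
  then have "g * exp (- \<rho> * g) \<le> 1 / \<rho>" using assms by (simp add: field_simps)
  moreover have "1 / \<rho> * 1 \<le> 1 / \<rho> * (1 + exp (- \<rho> * g))"
    using assms by (intro mult_left_mono) auto
  moreover have "g * (1 + exp (- \<rho> * g)) = g + g * exp (- \<rho> * g)" by (simp add: algebra_simps)
  ultimately have "(g - 1 / \<rho>) * (1 + exp (- \<rho> * g)) \<le> g"
    by (simp add: left_diff_distrib)
  moreover have "1 + exp (- \<rho> * g) > 0" by (simp add: add_pos_pos)
  ultimately show ?thesis using True by (simp add: pos_le_divide_eq)
next
  case False
  have "- \<rho> * g \<le> 1 + exp (- \<rho> * g)" using exp_ge_add_one_self[of "- \<rho> * g"] by linarith
  then have "- 1 / \<rho> * (1 + exp (- \<rho> * g)) \<le> g" using assms by (simp add: field_simps)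
  moreover have "1 + exp (- \<rho> * g) > 0" by (simp add: add_pos_pos)
  ultimately show ?thesis using False by (simp add: pos_le_divide_eq)
qed

lemma drift_cutoff_exists:
  fixes a b :: "real \<Rightarrow> real"
  assumes a: "circle_Ck 0 a" "\<And>x. a x > 0"
    and b: "circle_Ck 0 b" "\<And>x. (b has_real_derivative b' x) (at x)" "circle_Ck 0 b'"
    and sign: "b x\<^sub>0 < 0" "b x\<^sub>1 > 0" and \<delta>: "\<delta> > 0"
  obtains \<psi> \<psi>' \<Theta> where "circle_Ck 0 \<psi>" "\<And>x. (\<psi> has_real_derivative \<psi>' x) (at x)" "circle_Ck 0 \<psi>'"
    "\<And>x. 0 < \<psi> x" "\<And>x. \<psi> x < 1" "\<And>x. b x = 0 \<Longrightarrow> max 0 (b' x) - \<delta> \<le> \<psi> x * b' x"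
    "circle_Ck 0 \<Theta>" "\<And>x. (\<Theta> has_real_derivative \<psi> x * b x / a x) (at x)"
proof -
  have anz: "a x \<noteq> 0" for x using a(2)[of x] by simp
  \<comment> \<open>Budget for \<delta>: a quarter each for replacing the quotient by b' in the
    product and in the positive part, and half for the logistic function through \<rho> = 2 /
    \<delta>.\<close>
  obtain h where h: "h > 0" "\<And>x. \<bar>(b (x + h) - b x) / h - b' x\<bar> < \<delta> / 4"
    using difference_quotient_approx[OF b] \<delta> by (metis divide_pos_pos zero_less_numeral)
  define g where "g x = (b (x + h) - b x) / h" for x
  define g' where "g' x = (b' (x + h) - b' x) / h" for x
  have shift: "circle_Ck 0 (\<lambda>x. f (x + h))" if "circle_Ck 0 f" for f :: "real \<Rightarrow> real"
    using that unfolding circle_Ck_0_iff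
    by (auto simp: add.assoc add.commute[of 1] intro!: continuous_on_compose2[of UNIV f] continuous_intros)
      (simp add: add.assoc[symmetric])
  have g: "circle_Ck 0 g" "circle_Ck 0 g'"
    unfolding g_def g'_def using h(1) by (auto intro!: circle_Ck_0_divide circle_Ck_0_diff shift b circle_Ck_0_const)
  have dg: "(g has_real_derivative g' x) (at x)" for x
  proof -
    have "((\<lambda>x. b (x + h)) has_real_derivative b' (x + h) * 1) (at x)"
      by (rule DERIV_chain2[OF b(2)]) (auto intro!: derivative_eq_intros)
    then show ?thesis
      unfolding g_def g'_def using b(2)[of x] h(1) by (auto intro!: derivative_eq_intros)
  qed
  define \<rho> where "\<rho> = 2 / \<delta>"
  have \<rho>: "\<rho> > 0" "1 / \<rho> = \<delta> / 2" using \<delta> by (auto simp: \<rho>_def)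
  define E where "E x = exp (- \<rho> * g x)" for x
  have E: "circle_Ck 0 E"
    using g(1) unfolding E_def circle_Ck_0_iff by (auto intro!: continuous_intros)
  have Epos: "E x > 0" for x by (simp add: E_def)
  then have Enz: "1 + E x \<noteq> 0" for x by (metis add_pos_pos less_irrefl zero_less_one)
  define \<psi>\<^sub>0 where "\<psi>\<^sub>0 x = 1 / (1 + E x)" for x
  define \<psi>\<^sub>0' where "\<psi>\<^sub>0' x = \<rho> * g' x * E x / ((1 + E x) * (1 + E x))" for x
  have \<psi>0: "circle_Ck 0 \<psi>\<^sub>0" "circle_Ck 0 \<psi>\<^sub>0'"
    unfolding \<psi>\<^sub>0_def \<psi>\<^sub>0'_def using Enz
    by (auto intro!: circle_Ck_0_divide circle_Ck_0_mult circle_Ck_0_add circle_Ck_0_const E g)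
  have d\<psi>0: "(\<psi>\<^sub>0 has_real_derivative \<psi>\<^sub>0' x) (at x)" for x
  proof -
    have "(E has_real_derivative - \<rho> * g' x * E x) (at x)"
      unfolding E_def using dg[of x] by (auto intro!: derivative_eq_intros)
    then show ?thesis
      unfolding \<psi>\<^sub>0_def \<psi>\<^sub>0'_def using Enz[of x] by (auto intro!: derivative_eq_intros)
  qed
  have \<psi>01: "0 < \<psi>\<^sub>0 x" "\<psi>\<^sub>0 x < 1" for x
    using Epos[of x] by (auto simp: \<psi>\<^sub>0_def intro!: divide_pos_pos)
  have \<psi>b: "max 0 (b' x) - \<delta> \<le> \<psi>\<^sub>0 x * b' x" for x
  proof -
    have close: "\<bar>g x - b' x\<bar> \<le> \<delta> / 4" using h(2)[of x] by (simp add: g_def)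
    have "max 0 (g x) - \<delta> / 2 \<le> \<psi>\<^sub>0 x * g x"
      using logistic_approx_positive_part[OF \<rho>(1), of "g x"] \<rho>(2) by (simp add: \<psi>\<^sub>0_def E_def)
    moreover have "\<psi>\<^sub>0 x * g x - \<psi>\<^sub>0 x * b' x \<le> \<delta> / 4"
    proof -
      have "\<psi>\<^sub>0 x * (g x - b' x) \<le> \<psi>\<^sub>0 x * \<bar>g x - b' x\<bar>"
        using \<psi>01[of x] by (intro mult_left_mono) auto
      also have "\<dots> \<le> 1 * \<bar>g x - b' x\<bar>"
        using \<psi>01[of x] by (intro mult_right_mono) auto
      finally have "\<psi>\<^sub>0 x * (g x - b' x) \<le> \<bar>g x - b' x\<bar>" by simp
      with close show ?thesis by (simp add: right_diff_distrib)
    qed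
    ultimately show ?thesis using close by linarith
  qed
  \<comment> \<open>With this weight \<open>k x * (b x * \<omega> x)\<close> is the prospective
    derivative of \<Theta> for \<psi> = \<open>\<psi>\<^sub>0\<close> k. The bound k <= 1 keeps
    \<psi> < 1, and k = 1 at the zeros preserves the logistic estimate there.\<close>
  define \<omega> where "\<omega> x = \<psi>\<^sub>0 x / a x" for x
  have \<omega>: "circle_Ck 0 \<omega>" "\<omega> x > 0" for x
    unfolding \<omega>_def using \<psi>01(1) a(2) by (auto intro!: circle_Ck_0_divide \<psi>0 a anz)
  obtain k k' where k: "circle_Ck 0 k" "\<And>x. (k has_real_derivative k' x) (at x)" "circle_Ck 0 k'"
    "\<And>x. 0 < k x" "\<And>x. k x \<le> 1" "\<And>x. b x = 0 \<Longrightarrow> k x = 1"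
    "integral {0..1} (\<lambda>x. k x * (b x * \<omega> x)) = 0"
    by (rule balancing_cutoff[OF b sign \<omega>]) (rule that)
  have "circle_Ck 0 (\<lambda>x. k x * (b x * \<omega> x))"
    by (intro circle_Ck_0_mult k b \<omega>)
  then obtain \<Theta> where \<Theta>: "circle_Ck 0 \<Theta>" "\<And>x. (\<Theta> has_real_derivative k x * (b x * \<omega> x)) (at x)"
    by (rule circle_Ck_0_antiderivative_mean_zero[OF _ k(7)]) (rule that)
  show thesis
  proof (rule that)
    show "circle_Ck 0 (\<lambda>x. \<psi>\<^sub>0 x * k x)" "circle_Ck 0 (\<lambda>x. \<psi>\<^sub>0' x * k x + \<psi>\<^sub>0 x * k' x)"
      by (intro circle_Ck_0_add circle_Ck_0_mult \<psi>0 k)+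
    show "((\<lambda>x. \<psi>\<^sub>0 x * k x) has_real_derivative \<psi>\<^sub>0' x * k x + \<psi>\<^sub>0 x * k' x) (at x)" for x
      using d\<psi>0[of x] k(2)[of x] by (auto intro!: derivative_eq_intros)
    show "0 < \<psi>\<^sub>0 x * k x" for x using \<psi>01[of x] k(4)[of x] by simp
    show "\<psi>\<^sub>0 x * k x < 1" for x
    proof -
      have "\<psi>\<^sub>0 x * k x \<le> \<psi>\<^sub>0 x * 1" using \<psi>01[of x] k(5)[of x] by (intro mult_left_mono) auto
      with \<psi>01(2)[of x] show ?thesis by linarith
    qed
    show "max 0 (b' x) - \<delta> \<le> \<psi>\<^sub>0 x * k x * b' x" if "b x = 0" for x
      using \<psi>b[of x] k(6)[OF that] by simp
    show "circle_Ck 0 \<Theta>" by (rule \<Theta>)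
    show "(\<Theta> has_real_derivative \<psi>\<^sub>0 x * k x * b x / a x) (at x)" for x
      using \<Theta>(2)[of x] by (simp add: \<omega>_def mult_ac)
  qed
qed

section \<open>The limit of the principal eigenvalue\<close>

text \<open>The maximum is expressed through a maximiser, so that its being attained is part of the
  claim.\<close>

theorem theorem5p1:
  fixes a b c :: "real \<Rightarrow> real" and \<Lambda> :: "real \<Rightarrow> real"
  assumes "circle_Ck 2 a" and "\<And>x. a x > 0"
    and "circle_Ck 1 b"
    and "circle_Ck 0 c"
    and "\<exists>x. b x > 0" and "\<exists>x. b x < 0"
    and "finite_zero_structure b"
    and "\<And>\<epsilon>. \<epsilon> > 0 \<Longrightarrow> principal_eigenvalue (circle_op a b c \<epsilon>) (\<Lambda> \<epsilon>)"
  shows "\<exists>x\<^sub>0. b x\<^sub>0 = 0 \<and>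
           (\<forall>x. b x = 0 \<longrightarrow> - max 0 (deriv b x) + c x \<le> - max 0 (deriv b x\<^sub>0) + c x\<^sub>0) \<and>
           (\<Lambda> \<longlongrightarrow> - max 0 (deriv b x\<^sub>0) + c x\<^sub>0) (at_right 0)"
proof -
  have a1: "circle_Ck (Suc (Suc 0)) a" using assms(1) by (simp only: numeral_2_eq_2)
  note a = circle_Ck_Suc_imp_0[OF a1] circle_Ck_Suc_real_derivative(1)[OF a1]
    circle_Ck_Suc_imp_0[OF circle_Ck_Suc_real_derivative(2)[OF a1]] assms(2)
  have b1: "circle_Ck (Suc 0) b" using assms(3) by (simp only: One_nat_def)
  note b = circle_Ck_Suc_imp_0[OF b1] circle_Ck_Suc_real_derivative[OF b1]
  note c = assms(4)
  obtain xp xn where sign: "b xn < 0" "b xp > 0" using assms(5,6) by blast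
  define V where "V x = - max 0 (deriv b x) + c x" for x
  have V: "circle_Ck 0 V"
    unfolding V_def using b(3) c by (auto simp: circle_Ck_0_iff intro!: continuous_intros)
  \<comment> \<open>Restriction to one period makes the zero set compact; \<open>frac\<close> brings
    every zero back into it.\<close>
  define Z where "Z = {0..1} \<inter> {x. b x = 0}"
  have contb: "continuous_on S b" for S
    using b(1) by (meson circle_Ck_0_iff continuous_on_subset subset_UNIV)
  have "closed {x. b x = 0}"
    using contb by (intro closed_Collect_eq continuous_on_const)
  then have "compact Z"
    unfolding Z_def by (rule compact_Int_closed[OF compact_Icc])
  obtain z where z: "b z = 0"
  proof (cases "xn \<le> xp")
    case True
    then show ?thesis using IVT'[of b xn 0 xp] sign contb that by auto
  next
    case False
    then show ?thesis using IVT2'[of b xn 0 xp] sign contb that by auto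
  qed
  have fracZ: "frac x \<in> Z" if "b x = 0" for x
    using that circle_Ck_0_frac[OF b(1), of x]
    by (simp add: Z_def frac_ge_0 less_imp_le[OF frac_lt_1])
  have "continuous_on Z V" using V by (meson circle_Ck_0_iff continuous_on_subset subset_UNIV)
  then obtain x\<^sub>0 where x0: "x\<^sub>0 \<in> Z" "\<And>x. x \<in> Z \<Longrightarrow> V x \<le> V x\<^sub>0"
    using continuous_attains_sup[OF \<open>compact Z\<close>] fracZ[OF z] by blast
  have bx0: "b x\<^sub>0 = 0" using x0(1) by (simp add: Z_def)
  have max: "V x \<le> V x\<^sub>0" if "b x = 0" for x
    using x0(2)[OF fracZ[OF that]] circle_Ck_0_frac[OF V, of x] by simp
  have "(\<Lambda> \<longlongrightarrow> V x\<^sub>0) (at_right 0)"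
  proof (rule tendstoI)
    fix e :: real assume e: "e > 0"
    have "- max 0 (deriv b x\<^sub>0) + c x\<^sub>0 - e / 2 = V x\<^sub>0 - e / 2" by (simp add: V_def)
    with eigenvalue_lower_bound_at_zero[OF circle_Ck_0_isCont[OF a(1)] assms(2)
        circle_Ck_0_isCont[OF c] bx0 b(2) half_gt_zero[OF e]]
    have lower: "\<forall>\<^sub>F \<epsilon> in at_right 0. \<forall>\<mu> v. real_eigenfunction (\<lambda>x. \<epsilon> * a x) b c \<mu> v \<longrightarrow>
        (\<forall>x. v x > 0) \<longrightarrow> V x\<^sub>0 - e / 2 \<le> \<mu>"
      by simp
    \<comment> \<open>Using e / 4 leaves the strict inequality against e / 2 that the upper bound
      asks for.\<close>
    have "e / 4 > 0" using e by simp
    then obtain \<psi> \<psi>' \<Theta> where \<psi>: "circle_Ck 0 \<psi>" "\<And>x. (\<psi> has_real_derivative \<psi>' x) (at x)" "circle_Ck 0 \<psi>'"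
      "\<And>x. 0 < \<psi> x" "\<And>x. \<psi> x < 1" "\<And>x. b x = 0 \<Longrightarrow> max 0 (deriv b x) - e / 4 \<le> \<psi> x * deriv b x"
      "circle_Ck 0 \<Theta>" "\<And>x. (\<Theta> has_real_derivative \<psi> x * b x / a x) (at x)"
      by (rule drift_cutoff_exists[OF a(1,4) b sign]) (rule that)
    have "c x - \<psi> x * deriv b x < V x\<^sub>0 + e / 2" if "b x = 0" for x
      using \<psi>(6)[OF that] max[OF that] e by (simp add: V_def)
    then have upper: "\<forall>\<^sub>F \<epsilon> in at_right 0. \<forall>\<mu> u. real_eigenfunction (\<lambda>x. \<epsilon> * a x) b c \<mu> u \<longrightarrow>
        (\<exists>x. u x \<noteq> 0) \<longrightarrow> \<mu> \<le> V x\<^sub>0 + e / 2"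
      by (rule eigenvalue_upper_bound[OF a b c \<psi>(1-5,7,8)])
    show "\<forall>\<^sub>F \<epsilon> in at_right 0. dist (\<Lambda> \<epsilon>) (V x\<^sub>0) < e"
      using lower upper eventually_at_right_less
    proof eventually_elim
      case (elim \<epsilon>)
      have ev: "circle_eigenvalue (circle_op a b c \<epsilon>) (complex_of_real (\<Lambda> \<epsilon>))"
        and top: "\<And>\<mu>. circle_eigenvalue (circle_op a b c \<epsilon>) \<mu> \<Longrightarrow> Re \<mu> \<le> \<Lambda> \<epsilon>"
        using assms(8)[OF elim(3)] by (auto simp: principal_eigenvalue_def)
      \<comment> \<open>The upper bound applies to \<Lambda> itself, through a real eigenfunction of
        unknown sign.\<close>
      have le: "\<Lambda> \<epsilon> \<le> V x\<^sub>0 + e / 2"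
        by (rule circle_eigenvalue_real_eigenfunction[OF ev]) (use elim(2) in blast)
      have pos: "\<epsilon> * a x > 0" for x using elim(3) assms(2)[of x] by simp
      then have anz: "\<epsilon> * a x \<noteq> 0" for x by (metis less_irrefl)
      have \<epsilon>a: "circle_Ck 0 (\<lambda>x. \<epsilon> * a x)" by (intro circle_Ck_0_mult circle_Ck_0_const a)
      \<comment> \<open>Division by \<epsilon> a brings the eigenvalue equation to the form u'' + B
        u' + C u = \<mu> A u with A = 1 / (\<epsilon> a). Maximality of \<Lambda> gives \<mu> \<le>
        \<Lambda>, so a lower bound for \<mu> passes to \<Lambda>.\<close>
      obtain \<mu> v v' where v: "circle_Ck 0 v" "\<And>x. v x > 0" "\<And>x. (v has_real_derivative v' x) (at x)"
        "\<And>x. (v' has_real_derivative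
           \<mu> * (1 / (\<epsilon> * a x)) * v x - b x / (\<epsilon> * a x) * v' x - c x / (\<epsilon> * a x) * v x) (at x)"
        by (rule positive_periodic_eigenfunction[OF circle_Ck_0_divide[OF circle_Ck_0_const \<epsilon>a anz, of 1]
              divide_pos_pos[OF zero_less_one pos]
              circle_Ck_0_divide[OF b(1) \<epsilon>a anz] circle_Ck_0_divide[OF c \<epsilon>a anz]]) (rule that)
      define v'' where "v'' x = \<mu> * (1 / (\<epsilon> * a x)) * v x - b x / (\<epsilon> * a x) * v' x - c x / (\<epsilon> * a x) * v x" for x
      have "\<epsilon> * a x * v'' x + b x * v' x + c x * v x = \<mu> * v x" for x
        using anz[of x] by (simp add: v''_def right_diff_distrib)
      with v(1,3) v(4)[folded v''_def] have eig: "real_eigenfunction (\<lambda>x. \<epsilon> * a x) b c \<mu> v"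
        unfolding real_eigenfunction_def by blast
      have "v 0 \<noteq> 0" using v(2)[of 0] by simp
      from top[OF circle_eigenvalue_of_real_eigenfunction[OF eig this anz a(1) b(1) c]]
      have "\<mu> \<le> \<Lambda> \<epsilon>" by simp
      moreover have "V x\<^sub>0 - e / 2 \<le> \<mu>"
        using elim(1) eig v(2) by blast
      ultimately show ?case
        using le e by (simp add: dist_real_def abs_less_iff)
    qed
  qed
  then show ?thesis
    using bx0 max by (intro exI[of _ x\<^sub>0]) (auto simp: V_def)
qed

end
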